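(* Suppose $m\ge p$. Then the $gl(p)\times gl(m|n)$ highest weight vectors in $\mathbb{C}[\mathbf{x},\boldsymbol{\eta}]$ (taken up to nonzero scalar multiples) form an abelian semigroup generated by $\Delta_r$, $r=1,\ldots,p$. The highest weight vector associated to the weight $\lambda$ (a Young diagram of length at most $p$, with column lengths $\lambda'_1\ge\cdots\ge\lambda'_t$, $t=\lambda_1$) is given by the product $\Delta_{\lambda'_1}\cdots\Delta_{\lambda'_t}$.
   Context: $\mathbb{C}[\mathbf{x},\boldsymbol{\eta}]$ is the polynomial superalgebra over $\mathbb{C}$ in even variables $x_l^i$ ($1\le i\le p$, $1\le l\le m$) and odd (anticommuting) variables $\eta_k^i$ ($1\le i\le p$, $1\le k\le n$). It is identified with the (super)symmetric algebra $S(\mathbb{C}^p\otimes\mathbb{C}^{m|n})$ via $x_l^i=e_l\otimes e^i$, $\eta_k^i=f_k\otimes e^i$, where $e^1,\ldots,e^p$ is the standard basis of $\mathbb{C}^p$ and $e_1,\ldots,e_m;f_1,\ldots,f_n$ the standard (even; odd) basis of $\mathbb{C}^{m|n}$, with the induced action of $gl(p)\times gl(m|n)$. The Cartan subalgebra of $gl(p)$ is spanned by $\sum_{j=1}^m x_j^i\frac{\partial}{\partial x_j^i}+\sum_{j=1}^n\eta_j^i\frac{\partial}{\partial\eta_j^i}$ ($1\le i\le p$), and that of $gl(m|n)$ by $\sum_{j=1}^p x_s^j\frac{\partial}{\partial x_s^j}$ ($1\le s\le m$) and $\sum_{j=1}^p\eta_k^j\frac{\partial}{\partial\eta_k^j}$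 ($1\le k\le n$). The simple root vectors are: for $gl(p)$, $\sum_{j=1}^m x_j^{i-1}\frac{\partial}{\partial x_j^i}+\sum_{j=1}^n\eta_j^{i-1}\frac{\partial}{\partial\eta_j^i}$ ($1<i\le p$); for $gl(m|n)$, $\sum_{j=1}^p x_{s-1}^j\frac{\partial}{\partial x_s^j}$ ($1<s\le m$), $\sum_{j=1}^p\eta_{k-1}^j\frac{\partial}{\partial\eta_k^j}$ ($1<k\le n$), $\sum_{j=1}^p x_m^j\frac{\partial}{\partial\eta_1^j}$. A highest weight vector is a nonzero weight vector annihilated by all these simple root vectors. It is associated to $\lambda$ if its $gl(p)$-weight is $(\lambda_1,\ldots,\lambda_p)$ and its $gl(m|n)$-weight is $(\lambda_1,\ldots,\lambda_m;\langle\lambda'_1-m\rangle,\ldots,\langle\lambda'_n-m\rangle)$, where $\lambda'$ is the transpose of $\lambda$ and $\langle l\rangle=\max(l,0)$. For $1\le r\le\min(m,p)$, $\Delta_r$ is the determinant of the $r\times r$ matrix $(x_l^i)_{1\le i,l\le r}$. *)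

theory Defs
  imports
    "HOL-Library.Poly_Mapping"
    "Jordan_Normal_Form.Determinant"
begin

section \<open>The polynomial superalgebra\<close>

type_synonym cpoly = "((nat \<times> nat) \<Rightarrow>\<^sub>0 nat) \<Rightarrow>\<^sub>0 complex"

text \<open>
  The even variable \<open>x\<^sub>l\<^sup>i\<close> and the odd variable \<open>\<eta>\<^sub>k\<^sup>i\<close> are indexed by the pairs \<open>(i, l)\<close> and
  \<open>(i, k)\<close>, upper index first. An element is a finite sum of terms \<open>f\<^sub>A \<eta>\<^sub>A\<close>, where \<open>f\<^sub>A\<close> is an
  ordinary polynomial in the even variables and \<open>\<eta>\<^sub>A\<close> is the product of the odd variables in the
  finite set \<open>A\<close>, written in increasing lexicographic order of their indices. The type has
  infinitely many variables; the algebra for given \<open>p, m, n\<close> is the set \<open>superalg p m n\<close> below.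
\<close>

typedef superpoly =
  "{F :: (nat \<times> nat) set \<Rightarrow> cpoly. finite {A. F A \<noteq> 0} \<and> (\<forall>A. F A \<noteq> 0 \<longrightarrow> finite A)}"
  morphisms odd_coeff Abs_superpoly
  by (rule exI[of _ "\<lambda>_. 0"]) simp

(* Keep cpoly opaque: lifting from superpoly should stop at functions into cpoly. *)
lifting_forget poly_mapping.lifting

setup_lifting type_definition_superpoly

text \<open>The exponent of the sign in \<open>\<eta>\<^sub>A \<eta>\<^sub>B = \<plusminus> \<eta>\<^bsub>A \<union> B\<^esub>\<close> for disjoint \<open>A\<close>, \<open>B\<close>.\<close>

definition inversions :: "(nat \<times> nat) set \<Rightarrow> (nat \<times> nat) set \<Rightarrow> nat" where
  "inversions A B = card {(a, b). a \<in> A \<and> b \<in> B \<and> (b, a) \<in> less_than <*lex*> less_than}"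

lemma inversions_empty [simp]: "inversions {} B = 0" "inversions A {} = 0"
  by (simp_all add: inversions_def)

lemma finite_inversions:
  assumes "finite A" "finite B"
  shows "finite {(a, b). a \<in> A \<and> b \<in> B \<and> (b, a) \<in> less_than <*lex*> less_than}"
  by (rule finite_subset[OF _ finite_cartesian_product[OF assms]]) auto

lemma inversions_Un_left:
  assumes "finite A" "finite B" "finite C" "A \<inter> B = {}"
  shows "inversions (A \<union> B) C = inversions A C + inversions B C"
proof -
  let ?I = "\<lambda>A B. {(a, b). a \<in> A \<and> b \<in> B \<and> (b, a) \<in> less_than <*lex*> less_than}"
  have "?I (A \<union> B) C = ?I A C \<union> ?I B C" "?I A C \<inter> ?I B C = {}"
    using assms(4) by blast+
  then show ?thesis
    unfolding inversions_def
    by (simp only: card_Un_disjoint finite_inversions assms(1-3))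
qed

lemma inversions_Un_right:
  assumes "finite A" "finite B" "finite C" "B \<inter> C = {}"
  shows "inversions A (B \<union> C) = inversions A B + inversions A C"
proof -
  let ?I = "\<lambda>A B. {(a, b). a \<in> A \<and> b \<in> B \<and> (b, a) \<in> less_than <*lex*> less_than}"
  have "?I A (B \<union> C) = ?I A B \<union> ?I A C" "?I A B \<inter> ?I A C = {}"
    using assms(4) by blast+
  then show ?thesis
    unfolding inversions_def
    by (simp only: card_Un_disjoint finite_inversions assms(1-3))
qed

instantiation superpoly :: ring_1
begin

lift_definition zero_superpoly :: superpoly is "\<lambda>_. 0" by simp

lift_definition one_superpoly :: superpoly is "\<lambda>A. if A = {} then 1 else 0" by simp

lift_definition plus_superpoly :: "superpoly \<Rightarrow> superpoly \<Rightarrow> superpoly" is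
  "\<lambda>F G A. F A + G A"
proof (intro conjI allI impI; (elim conjE)?)
  fix F G :: "(nat \<times> nat) set \<Rightarrow> cpoly" assume "finite {A. F A \<noteq> 0}" "finite {A. G A \<noteq> 0}"
  then show "finite {A. F A + G A \<noteq> 0}"
    by (rule_tac finite_subset[of _ "{A. F A \<noteq> 0} \<union> {A. G A \<noteq> 0}"]) auto
next
  fix F G :: "(nat \<times> nat) set \<Rightarrow> cpoly" and A
  assume "\<forall>A. F A \<noteq> 0 \<longrightarrow> finite A" "\<forall>A. G A \<noteq> 0 \<longrightarrow> finite A" "F A + G A \<noteq> 0"
  then show "finite A" by (cases "F A = 0") auto
qed

lift_definition uminus_superpoly :: "superpoly \<Rightarrow> superpoly" is "\<lambda>F A. - F A" by simp

definition minus_superpoly :: "superpoly \<Rightarrow> superpoly \<Rightarrow> superpoly" where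
  "minus_superpoly F G = F + - G"

lift_definition times_superpoly :: "superpoly \<Rightarrow> superpoly \<Rightarrow> superpoly" is
  "\<lambda>F G C. \<Sum>A\<in>Pow C. (- 1) ^ inversions A (C - A) * F A * G (C - A)"
proof (intro conjI allI impI; (elim conjE)?)
  fix F G :: "(nat \<times> nat) set \<Rightarrow> cpoly"
  assume *: "finite {A. F A \<noteq> 0}" "finite {A. G A \<noteq> 0}"
  show "finite {C. (\<Sum>A\<in>Pow C. (- 1) ^ inversions A (C - A) * F A * G (C - A)) \<noteq> 0}"
  proof (rule finite_subset)
    show "finite ((\<lambda>(A, B). A \<union> B) ` ({A. F A \<noteq> 0} \<times> {A. G A \<noteq> 0}))"
      using * by (intro finite_imageI finite_cartesian_product)
    show "{C. (\<Sum>A\<in>Pow C. (- 1) ^ inversions A (C - A) * F A * G (C - A)) \<noteq> 0}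
        \<subseteq> (\<lambda>(A, B). A \<union> B) ` ({A. F A \<noteq> 0} \<times> {A. G A \<noteq> 0})"
    proof
      fix C assume "C \<in> {C. (\<Sum>A\<in>Pow C. (- 1) ^ inversions A (C - A) * F A * G (C - A)) \<noteq> 0}"
      then have "(\<Sum>A\<in>Pow C. (- 1) ^ inversions A (C - A) * F A * G (C - A)) \<noteq> 0" by simp
      then obtain A where "A \<in> Pow C" "(- 1) ^ inversions A (C - A) * F A * G (C - A) \<noteq> 0"
        by (rule sum.not_neutral_contains_not_neutral)
      then have "A \<subseteq> C" "F A \<noteq> 0" "G (C - A) \<noteq> 0" by auto
      then show "C \<in> (\<lambda>(A, B). A \<union> B) ` ({A. F A \<noteq> 0} \<times> {A. G A \<noteq> 0})"
        by (intro image_eqI[of _ _ "(A, C - A)"]) auto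
    qed
  qed
next
  fix F G :: "(nat \<times> nat) set \<Rightarrow> cpoly" and C
  assume "(\<Sum>A\<in>Pow C. (- 1) ^ inversions A (C - A) * F A * G (C - A)) \<noteq> 0"
  then show "finite C" by (cases "finite C") auto
qed

instance
proof
  fix F G H :: superpoly
  show "F + G + H = F + (G + H)" by transfer (simp add: add.assoc)
  show "F + G = G + F" by transfer (simp add: add.commute)
  show "0 + F = F" by transfer simp
  show "- F + F = 0" by transfer simp
  show "F - G = F + - G" by (rule minus_superpoly_def)
  show "(0 :: superpoly) \<noteq> 1" by transfer (auto dest: fun_cong[of _ _ "{}"])
  show "(F + G) * H = F * H + G * H"
    by transfer (simp add: distrib_left distrib_right sum.distrib)
  show "F * (G + H) = F * G + F * H"
    by transfer (simp add: distrib_left distrib_right sum.distrib)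
  show "1 * F = F"
  proof (transfer, elim conjE, rule ext)
    fix F :: "(nat \<times> nat) set \<Rightarrow> cpoly" and C
    assume *: "\<forall>A. F A \<noteq> 0 \<longrightarrow> finite A"
    show "(\<Sum>A\<in>Pow C. (- 1) ^ inversions A (C - A) * (if A = {} then 1 else 0) * F (C - A)) = F C"
    proof (cases "finite C")
      case True
      then have "(\<Sum>A\<in>Pow C. (- 1) ^ inversions A (C - A) * (if A = {} then 1 else 0) * F (C - A))
          = (\<Sum>A\<in>{{}}. (- 1) ^ inversions A (C - A) * (if A = {} then 1 else 0) * F (C - A))"
        by (intro sum.mono_neutral_right) auto
      then show ?thesis by simp
    next
      case False
      then show ?thesis using * by (subst sum.infinite) auto
    qed
  qed
  show "F * 1 = F"
  proof (transfer, elim conjE, rule ext)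
    fix F :: "(nat \<times> nat) set \<Rightarrow> cpoly" and C
    assume *: "\<forall>A. F A \<noteq> 0 \<longrightarrow> finite A"
    show "(\<Sum>A\<in>Pow C. (- 1) ^ inversions A (C - A) * F A * (if C - A = {} then 1 else 0)) = F C"
    proof (cases "finite C")
      case True
      then have "(\<Sum>A\<in>Pow C. (- 1) ^ inversions A (C - A) * F A * (if C - A = {} then 1 else 0))
          = (\<Sum>A\<in>{C}. (- 1) ^ inversions A (C - A) * F A * (if C - A = {} then 1 else 0))"
        by (intro sum.mono_neutral_right) auto
      then show ?thesis by simp
    next
      case False
      then show ?thesis using * by (subst sum.infinite) auto
    qed
  qed
  show "F * G * H = F * (G * H)"
  proof (transfer, elim conjE, rule ext)
    fix F G H :: "(nat \<times> nat) set \<Rightarrow> cpoly" and C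
    let ?s = "\<lambda>A B. (- 1 :: cpoly) ^ inversions A B"
    let ?L = "\<lambda>A B. ?s A (C - A) * (?s B (A - B) * F B * G (A - B)) * H (C - A)"
    let ?R = "\<lambda>B D. ?s B (C - B) * F B * (?s D (C - B - D) * G D * H (C - B - D))"
    show "(\<Sum>A\<in>Pow C. ?s A (C - A) * (\<Sum>B\<in>Pow A. ?s B (A - B) * F B * G (A - B)) * H (C - A))
        = (\<Sum>B\<in>Pow C. ?s B (C - B) * F B
            * (\<Sum>D\<in>Pow (C - B). ?s D (C - B - D) * G D * H (C - B - D)))"
    proof (cases "finite C")
      case True
      have fin: "finite A" if "A \<subseteq> C" for A using finite_subset[OF that True] .
      have eq: "?L A B = ?R B (A - B)" if AB: "A \<subseteq> C" "B \<subseteq> A" for A B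
      proof -
        have "finite A" "finite B" "finite (A - B)" "finite (C - A)" using AB fin by auto
        note un = inversions_Un_left[of B "A - B" "C - A"] inversions_Un_right[of B "A - B" "C - A"]
        have "B \<union> (A - B) = A" "(A - B) \<union> (C - A) = C - B" "B \<inter> (A - B) = {}"
          "(A - B) \<inter> (C - A) = {}" using AB by auto
        with un \<open>finite B\<close> \<open>finite (A - B)\<close> \<open>finite (C - A)\<close>
        have 1: "inversions A (C - A) = inversions B (C - A) + inversions (A - B) (C - A)"
          and 2: "inversions B (C - B) = inversions B (A - B) + inversions B (C - A)"
          by simp_all
        have 3: "C - B - (A - B) = C - A" using AB by auto
        show ?thesis unfolding 1 2 3 by (simp add: power_add mult_ac)
      qed
      have "(\<Sum>A\<in>Pow C. ?s A (C - A) * (\<Sum>B\<in>Pow A. ?s B (A - B) * F B * G (A - B)) * H (C - A))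
          = (\<Sum>A\<in>Pow C. \<Sum>B\<in>Pow A. ?L A B)"
        by (simp add: sum_distrib_left sum_distrib_right)
      also have "\<dots> = (\<Sum>(A, B)\<in>Sigma (Pow C) Pow. ?L A B)"
        by (rule sum.Sigma) (auto simp: fin True)
      also have "\<dots> = (\<Sum>(B, D)\<in>Sigma (Pow C) (\<lambda>B. Pow (C - B)). ?R B D)"
        by (rule sum.reindex_bij_witness[where i = "\<lambda>(B, D). (B \<union> D, B)" and j = "\<lambda>(A, B). (B, A - B)"])
          (auto simp: eq)
      also have "\<dots> = (\<Sum>B\<in>Pow C. \<Sum>D\<in>Pow (C - B). ?R B D)"
        by (rule sum.Sigma[symmetric]) (auto simp: True)
      also have "\<dots> = (\<Sum>B\<in>Pow C. ?s B (C - B) * F B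
            * (\<Sum>D\<in>Pow (C - B). ?s D (C - B - D) * G D * H (C - B - D)))"
        by (simp add: sum_distrib_left)
      finally show ?thesis .
    next
      case False
      then show ?thesis by simp
    qed
  qed
qed

end

lift_definition of_cpoly :: "cpoly \<Rightarrow> superpoly" is "\<lambda>f A. if A = {} then f else 0" by simp

lift_definition smult_super :: "complex \<Rightarrow> superpoly \<Rightarrow> superpoly" is
  "\<lambda>c F A. Poly_Mapping.single 0 c * F A"
proof (intro conjI; elim conjE)
  fix c and F :: "(nat \<times> nat) set \<Rightarrow> cpoly" assume "finite {A. F A \<noteq> 0}"
  then show "finite {A. Poly_Mapping.single 0 c * F A \<noteq> 0}"
    by (rule rev_finite_subset) auto
next
  fix c and F :: "(nat \<times> nat) set \<Rightarrow> cpoly" assume "\<forall>A. F A \<noteq> 0 \<longrightarrow> finite A"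
  then show "\<forall>A. Poly_Mapping.single 0 c * F A \<noteq> 0 \<longrightarrow> finite A"
    by (metis mult_zero_right)
qed

definition evar :: "nat \<Rightarrow> nat \<Rightarrow> cpoly" where
  "evar i l = Poly_Mapping.single (Poly_Mapping.single (i, l) 1) 1"

definition xvar :: "nat \<Rightarrow> nat \<Rightarrow> superpoly" where
  "xvar i l = of_cpoly (evar i l)"

lift_definition etavar :: "nat \<Rightarrow> nat \<Rightarrow> superpoly" is
  "\<lambda>i k A. if A = {(i, k)} then 1 else 0" by simp

definition superalg :: "nat \<Rightarrow> nat \<Rightarrow> nat \<Rightarrow> superpoly set" where
  "superalg p m n = {F. \<forall>A. odd_coeff F A \<noteq> 0 \<longrightarrow> A \<subseteq> {1..p} \<times> {1..n} \<and>
     (\<forall>a \<in> Poly_Mapping.keys (odd_coeff F A). Poly_Mapping.keys a \<subseteq> {1..p} \<times> {1..m})}"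

definition cpoly_deriv :: "nat \<Rightarrow> nat \<Rightarrow> cpoly \<Rightarrow> cpoly" where
  "cpoly_deriv i l f = (\<Sum>a \<in> Poly_Mapping.keys f.
     Poly_Mapping.single (a - Poly_Mapping.single (i, l) 1)
       (of_nat (Poly_Mapping.lookup a (i, l)) * Poly_Mapping.lookup f a))"

lift_definition dx :: "nat \<Rightarrow> nat \<Rightarrow> superpoly \<Rightarrow> superpoly" is
  "\<lambda>i l F A. cpoly_deriv i l (F A)"
proof (intro conjI; elim conjE)
  fix i l and F :: "(nat \<times> nat) set \<Rightarrow> cpoly" assume "finite {A. F A \<noteq> 0}"
  then show "finite {A. cpoly_deriv i l (F A) \<noteq> 0}"
    by (rule rev_finite_subset) (auto simp: cpoly_deriv_def)
next
  fix i l and F :: "(nat \<times> nat) set \<Rightarrow> cpoly" assume *: "\<forall>A. F A \<noteq> 0 \<longrightarrow> finite A"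
  have "cpoly_deriv i l (F A) = 0" if "F A = 0" for A
    using that by (simp add: cpoly_deriv_def)
  with * show "\<forall>A. cpoly_deriv i l (F A) \<noteq> 0 \<longrightarrow> finite A" by blast
qed

text \<open>
  The odd derivatives are left derivatives:
  \<open>\<partial>\<^bsub>\<eta>\<^esub> (\<eta> \<eta>\<^sub>A) = \<eta>\<^sub>A\<close> and \<open>\<partial>\<^bsub>\<eta>\<^esub> \<eta>\<^sub>A = 0\<close> if \<open>\<eta>\<close> does not occur in \<open>\<eta>\<^sub>A\<close>.
\<close>

lift_definition deta :: "nat \<Rightarrow> nat \<Rightarrow> superpoly \<Rightarrow> superpoly" is
  "\<lambda>i k F A. if (i, k) \<in> A then 0 else (- 1) ^ inversions {(i, k)} A * F (insert (i, k) A)"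
proof (intro conjI allI impI; (elim conjE)?)
  fix i k and F :: "(nat \<times> nat) set \<Rightarrow> cpoly" assume "finite {A. F A \<noteq> 0}"
  then have "finite ((\<lambda>A. A - {(i, k)}) ` {A. F A \<noteq> 0})" by simp
  moreover have "{A. (if (i, k) \<in> A then 0
      else (- 1) ^ inversions {(i, k)} A * F (insert (i, k) A)) \<noteq> 0}
      \<subseteq> (\<lambda>A. A - {(i, k)}) ` {A. F A \<noteq> 0}"
  proof
    fix A assume "A \<in> {A. (if (i, k) \<in> A then 0
      else (- 1) ^ inversions {(i, k)} A * F (insert (i, k) A)) \<noteq> 0}"
    then have "(i, k) \<notin> A" "F (insert (i, k) A) \<noteq> 0"
      by (auto split: if_splits)
    then show "A \<in> (\<lambda>A. A - {(i, k)}) ` {A. F A \<noteq> 0}"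
      by (intro image_eqI[where x = "insert (i, k) A"]) simp_all
  qed
  ultimately show "finite {A. (if (i, k) \<in> A then 0
      else (- 1) ^ inversions {(i, k)} A * F (insert (i, k) A)) \<noteq> 0}"
    by (rule rev_finite_subset)
next
  fix i k A and F :: "(nat \<times> nat) set \<Rightarrow> cpoly"
  assume "\<forall>A. F A \<noteq> 0 \<longrightarrow> finite A"
    "(if (i, k) \<in> A then 0 else (- 1) ^ inversions {(i, k)} A * F (insert (i, k) A)) \<noteq> 0"
  then have "finite (insert (i, k) A)" by (metis mult_zero_right)
  then show "finite A" by simp
qed


section \<open>The action of \<open>gl(p) \<times> gl(m|n)\<close> and highest weight vectors\<close>

text \<open>\<open>glp_op m n i j\<close> is the action of the matrix unit \<open>E\<^sub>i\<^sub>j\<close> of \<open>gl(p)\<close>. The following three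
  operators are the actions of the matrix units of \<open>gl(m|n)\<close> in its two even diagonal blocks and
  in its odd upper right block.\<close>

definition glp_op :: "nat \<Rightarrow> nat \<Rightarrow> nat \<Rightarrow> nat \<Rightarrow> superpoly \<Rightarrow> superpoly" where
  "glp_op m n i j F =
     (\<Sum>l\<in>{1..m}. xvar i l * dx j l F) + (\<Sum>k\<in>{1..n}. etavar i k * deta j k F)"

definition glm_op :: "nat \<Rightarrow> nat \<Rightarrow> nat \<Rightarrow> superpoly \<Rightarrow> superpoly" where
  "glm_op p s t F = (\<Sum>j\<in>{1..p}. xvar j s * dx j t F)"

definition gln_op :: "nat \<Rightarrow> nat \<Rightarrow> nat \<Rightarrow> superpoly \<Rightarrow> superpoly" where
  "gln_op p k l F = (\<Sum>j\<in>{1..p}. etavar j k * deta j l F)"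

definition glodd_op :: "nat \<Rightarrow> nat \<Rightarrow> nat \<Rightarrow> superpoly \<Rightarrow> superpoly" where
  "glodd_op p s k F = (\<Sum>j\<in>{1..p}. xvar j s * deta j k F)"

text \<open>The weights are given by the \<open>gl(p)\<close>-weight \<open>a\<close> and the \<open>gl(m|n)\<close>-weight \<open>(b; c)\<close>.\<close>

definition has_weight ::
  "nat \<Rightarrow> nat \<Rightarrow> nat \<Rightarrow> superpoly \<Rightarrow> (nat \<Rightarrow> complex) \<Rightarrow> (nat \<Rightarrow> complex) \<Rightarrow> (nat \<Rightarrow> complex) \<Rightarrow> bool"
where
  "has_weight p m n v a b c \<longleftrightarrow>
     (\<forall>i\<in>{1..p}. glp_op m n i i v = smult_super (a i) v) \<and>
     (\<forall>s\<in>{1..m}. glm_op p s s v = smult_super (b s) v) \<and>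
     (\<forall>k\<in>{1..n}. gln_op p k k v = smult_super (c k) v)"

definition highest_weight_vector :: "nat \<Rightarrow> nat \<Rightarrow> nat \<Rightarrow> superpoly \<Rightarrow> bool" where
  "highest_weight_vector p m n v \<longleftrightarrow>
     v \<in> superalg p m n \<and> v \<noteq> 0 \<and> (\<exists>a b c. has_weight p m n v a b c) \<and>
     (\<forall>i\<in>{1<..p}. glp_op m n (i - 1) i v = 0) \<and>
     (\<forall>s\<in>{1<..m}. glm_op p (s - 1) s v = 0) \<and>
     (\<forall>k\<in>{1<..n}. gln_op p (k - 1) k v = 0) \<and>
     (1 \<le> m \<and> 1 \<le> n \<longrightarrow> glodd_op p m 1 v = 0)"

text \<open>Young diagrams are sequences of row lengths \<open>\<lambda>\<^sub>1 \<ge> \<lambda>\<^sub>2 \<ge> \<dots>\<close>; the value at \<open>0\<close> is irrelevant.\<close>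

definition young_diagram_of_length_le :: "nat \<Rightarrow> (nat \<Rightarrow> nat) \<Rightarrow> bool" where
  "young_diagram_of_length_le p lam \<longleftrightarrow>
     (\<forall>i\<ge>1. lam (Suc i) \<le> lam i) \<and> (\<forall>i>p. lam i = 0)"

definition transpose_diagram :: "(nat \<Rightarrow> nat) \<Rightarrow> nat \<Rightarrow> nat" where
  "transpose_diagram lam j = card {i. 1 \<le> i \<and> j \<le> lam i}"

definition hwv_associated :: "nat \<Rightarrow> nat \<Rightarrow> nat \<Rightarrow> (nat \<Rightarrow> nat) \<Rightarrow> superpoly \<Rightarrow> bool" where
  "hwv_associated p m n lam v \<longleftrightarrow>
     highest_weight_vector p m n v \<and>
     has_weight p m n v
       (\<lambda>i. of_nat (lam i))
       (\<lambda>s. of_nat (lam s))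
       (\<lambda>k. of_int (max (int (transpose_diagram lam k) - int m) 0))"

definition Delta :: "nat \<Rightarrow> superpoly" where
  "Delta r = of_cpoly (det (mat r r (\<lambda>(i, l). evar (Suc i) (Suc l))))"


section \<open>The semigroup of highest weight vectors up to scalars\<close>

definition scalar_class :: "superpoly \<Rightarrow> superpoly set" where
  "scalar_class v = {smult_super c v | c. c \<noteq> 0}"

definition hwv_semigroup :: "nat \<Rightarrow> nat \<Rightarrow> nat \<Rightarrow> superpoly set monoid" where
  "hwv_semigroup p m n =
     \<lparr>carrier = scalar_class ` {v. highest_weight_vector p m n v},
      mult = (\<lambda>U V. {u * v | u v. u \<in> U \<and> v \<in> V}),
      one = scalar_class 1\<rparr>"

text \<open>The unit is included: it is the empty product, and the class of the highest weight vector
  \<open>1\<close> associated to the empty diagram.\<close>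

inductive_set generated_submonoid :: "('a, 'b) monoid_scheme \<Rightarrow> 'a set \<Rightarrow> 'a set"
  for G and S where
    one: "\<one>\<^bsub>G\<^esub> \<in> generated_submonoid G S"
  | incl: "x \<in> S \<Longrightarrow> x \<in> generated_submonoid G S"
  | mult: "x \<in> generated_submonoid G S \<Longrightarrow> y \<in> generated_submonoid G S \<Longrightarrow>
      x \<otimes>\<^bsub>G\<^esub> y \<in> generated_submonoid G S"

end

theory Submission
  imports Defs "HOL-Library.Product_Lexorder"
begin

text \<open>
  Three facts combine to give the result.

  A highest weight vector contains no odd variable (\<open>highest_weight_vector_no_odd\<close>). Commutators of
  the odd simple root vector with the even ones give the linear system \<open>\<Sum>\<^sub>j x\<^sub>s\<^sup>j \<partial>F/\<partial>\<eta>\<^sub>1\<^sup>j = 0\<close> for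
  \<open>1 \<le> s \<le> m\<close>, and because of \<open>m \<ge> p\<close> its first \<open>p\<close> equations have the nonzero determinant \<open>\<Delta>\<^sub>p\<close>. So
  \<open>F\<close> is free of \<open>\<eta>\<^sub>1\<close>, and the root vectors of \<open>gl(n)\<close> extend this to all odd variables. What remains
  is the classical problem for \<open>gl(p) \<times> gl(m)\<close>.

  A polynomial \<open>f\<close> in the entries of a \<open>p \<times> m\<close> matrix is a highest weight vector if and only if it is
  nonzero, homogeneous in each row and in each column, and invariant under adding a row to a later row
  and a column to a later column (\<open>highest_weight_vector_of_cpoly_iff\<close>): the root vectors generate
  these operations and the Cartan subalgebras generate the scalings. The leading minors visibly have
  these properties, and so have their products.

  Conversely, a matrix with nonzero leading minors is reduced by these operations to a diagonal
  matrix (\<open>generic_diagonalization\<close>). On diagonal matrices the row degrees determine \<open>f\<close> up to its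
  value at the unit matrix, and matrices with nonzero leading minors are dense, so the row degrees
  determine \<open>f\<close> up to a scalar (\<open>weight_space_one_dimensional\<close>). The row degrees decrease
  (\<open>weight_decreasing\<close>), so they form a Young diagram, and the product of the minors
  \<open>\<Delta>\<^sub>r\<close> over its column heights \<open>r\<close> has the same row degrees. Hence \<open>f\<close> is a multiple of that product.

  To avoid analysis, the invariance under an operator is derived from the restriction of \<open>f\<close> to
  lines, which is a univariate polynomial.
\<close>

section \<open>Evaluation of polynomials\<close>

text \<open>The values lie in an arbitrary commutative ring: complex numbers give the value at a point,
  linear polynomials give the restriction to a line.\<close>

definition monom_val :: "(nat \<times> nat \<Rightarrow> 'b::comm_ring_1) \<Rightarrow> (nat \<times> nat \<Rightarrow>\<^sub>0 nat) \<Rightarrow> 'b" where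
  "monom_val X a = (\<Prod>v\<in>Poly_Mapping.keys a. X v ^ Poly_Mapping.lookup a v)"

lemma monom_val_superset:
  assumes "finite S" "Poly_Mapping.keys a \<subseteq> S"
  shows "monom_val X a = (\<Prod>v\<in>S. X v ^ Poly_Mapping.lookup a v)"
  unfolding monom_val_def
  by (rule prod.mono_neutral_left) (use assms in \<open>auto simp: in_keys_iff\<close>)

lemma monom_val_0 [simp]: "monom_val X 0 = 1"
  by (simp add: monom_val_def)

lemma monom_val_single [simp]: "monom_val X (Poly_Mapping.single v k) = X v ^ k"
  by (cases "k = 0") (simp_all add: monom_val_def)

lemma monom_val_add: "monom_val X (a + b) = monom_val X a * monom_val X b"
proof -
  let ?S = "Poly_Mapping.keys a \<union> Poly_Mapping.keys b"
  have "Poly_Mapping.keys (a + b) \<subseteq> ?S" by (rule keys_add)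
  then show ?thesis
    by (simp add: monom_val_superset[of ?S] lookup_add power_add prod.distrib)
qed

definition ev :: "cpoly \<Rightarrow> (nat \<times> nat \<Rightarrow> complex) \<Rightarrow> complex" where
  "ev f X = (\<Sum>a\<in>Poly_Mapping.keys f. Poly_Mapping.lookup f a * monom_val X a)"

lemma ev_superset:
  assumes "finite S" "Poly_Mapping.keys f \<subseteq> S"
  shows "ev f X = (\<Sum>a\<in>S. Poly_Mapping.lookup f a * monom_val X a)"
  unfolding ev_def
  by (rule sum.mono_neutral_left) (use assms in \<open>auto simp: in_keys_iff\<close>)

lemma ev_0 [simp]: "ev 0 X = 0"
  by (simp add: ev_def)

lemma ev_single [simp]: "ev (Poly_Mapping.single a c) X = c * monom_val X a"
  by (cases "c = 0") (simp_all add: ev_def)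

lemma ev_1 [simp]: "ev 1 X = 1"
  by (simp flip: single_one)

lemma ev_of_nat [simp]: "ev (of_nat k) X = of_nat k"
  by (simp flip: single_of_nat)

lemma ev_evar [simp]: "ev (evar i l) X = X (i, l)"
  by (simp add: evar_def)

lemma ev_add [simp]: "ev (f + g) X = ev f X + ev g X"
proof -
  let ?S = "Poly_Mapping.keys f \<union> Poly_Mapping.keys g"
  have "Poly_Mapping.keys (f + g) \<subseteq> ?S" by (rule keys_add)
  then show ?thesis
    by (simp add: ev_superset[of ?S] lookup_add distrib_right sum.distrib)
qed

lemma ev_uminus [simp]: "ev (- f) X = - ev f X"
  using ev_add[of f "- f" X] by (simp add: eq_neg_iff_add_eq_0 add.commute)

lemma ev_diff [simp]: "ev (f - g) X = ev f X - ev g X"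
  using ev_add[of f "- g" X] by simp

lemma ev_sum [simp]: "ev (\<Sum>i\<in>I. f i) X = (\<Sum>i\<in>I. ev (f i) X)"
  by (induction I rule: infinite_finite_induct) simp_all

lemma cpoly_as_sum:
  "(f :: cpoly) = (\<Sum>a\<in>Poly_Mapping.keys f. Poly_Mapping.single a (Poly_Mapping.lookup f a))"
proof (rule poly_mapping_eqI)
  fix b
  show "Poly_Mapping.lookup f b = Poly_Mapping.lookup
    (\<Sum>a\<in>Poly_Mapping.keys f. Poly_Mapping.single a (Poly_Mapping.lookup f a)) b"
    by (auto simp: lookup_sum lookup_single when_def in_keys_iff)
qed

lemma ev_mult [simp]: "ev (f * g) X = ev f X * ev g X"
proof -
  let ?s = "\<lambda>f a. Poly_Mapping.single a (Poly_Mapping.lookup f a) :: cpoly"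
  have "ev (f * g) X = ev ((\<Sum>a\<in>Poly_Mapping.keys f. ?s f a) * (\<Sum>b\<in>Poly_Mapping.keys g. ?s g b)) X"
    by (simp flip: cpoly_as_sum)
  also have "\<dots> = (\<Sum>a\<in>Poly_Mapping.keys f. ev (?s f a) X) * (\<Sum>b\<in>Poly_Mapping.keys g. ev (?s g b) X)"
    by (simp add: sum_product mult_single monom_val_add mult_ac)
  also have "\<dots> = ev f X * ev g X"
    by (simp add: ev_def[of f] ev_def[of g])
  finally show ?thesis .
qed

lemma ev_power [simp]: "ev (f ^ k) X = ev f X ^ k"
  by (induction k) simp_all

interpretation ev_hom: comm_ring_hom "\<lambda>f. ev f X" for X
  by unfold_locales simp_all

text \<open>Distinct monomials are distinct characters of the multiplicative monoid of points, so Dedekind's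
  argument applies: doubling a coordinate in which \<open>a\<close> and \<open>b\<close> have different exponents yields a
  second relation, and a combination of the two relations that cancels \<open>b\<close> is shorter and still
  contains \<open>a\<close>.\<close>

lemma monom_val_independent:
  assumes "finite K" "\<forall>X. (\<Sum>a\<in>K. c a * monom_val X a) = 0" "a \<in> K"
  shows "c a = (0 :: complex)"
  using assms
proof (induction K arbitrary: c a rule: finite_induct)
  case (insert b K)
  have *: "c a = 0" if a: "a \<in> K" for a
  proof -
    from a insert.hyps have "a \<noteq> b" by blast
    then obtain v where v: "Poly_Mapping.lookup a v \<noteq> Poly_Mapping.lookup b v"
      by (meson poly_mapping_eqI)
    define c' where "c' d = c d * (2 ^ Poly_Mapping.lookup d v - 2 ^ Poly_Mapping.lookup b v)" for d
    have "(\<Sum>d\<in>K. c' d * monom_val X d) = 0" for X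
    proof -
      define X' where "X' = X(v := 2 * X v)"
      have X': "monom_val X' d = 2 ^ Poly_Mapping.lookup d v * monom_val X d" for d
      proof -
        let ?S = "insert v (Poly_Mapping.keys d)"
        have "monom_val X' d = (\<Prod>u\<in>?S. X' u ^ Poly_Mapping.lookup d u)"
          by (rule monom_val_superset) auto
        also have "\<dots> = (\<Prod>u\<in>?S. (if u = v then 2 ^ Poly_Mapping.lookup d v else 1)
            * X u ^ Poly_Mapping.lookup d u)"
          by (rule prod.cong) (auto simp: X'_def power_mult_distrib)
        also have "\<dots> = 2 ^ Poly_Mapping.lookup d v * (\<Prod>u\<in>?S. X u ^ Poly_Mapping.lookup d u)"
          by (simp add: prod.distrib prod.delta)
        also have "(\<Prod>u\<in>?S. X u ^ Poly_Mapping.lookup d u) = monom_val X d"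
          by (rule monom_val_superset[symmetric]) auto
        finally show ?thesis .
      qed
      have "0 = (\<Sum>d\<in>insert b K. c d * monom_val X' d)
          - 2 ^ Poly_Mapping.lookup b v * (\<Sum>d\<in>insert b K. c d * monom_val X d)"
        using insert.prems(1) by simp
      also have "\<dots> = (\<Sum>d\<in>insert b K. c' d * monom_val X d)"
        by (simp only: sum_distrib_left sum_subtractf[symmetric])
          (simp add: X' c'_def algebra_simps)
      also have "\<dots> = (\<Sum>d\<in>K. c' d * monom_val X d)"
        using insert.hyps by (simp add: c'_def)
      finally show ?thesis by simp
    qed
    then have "c' a = 0" using insert.IH a by blast
    moreover have "(2 :: complex) ^ Poly_Mapping.lookup a v \<noteq> 2 ^ Poly_Mapping.lookup b v"
    proof -
      have "(of_nat (2 ^ Poly_Mapping.lookup a v) :: complex) \<noteq> of_nat (2 ^ Poly_Mapping.lookup b v)"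
        using v by (simp only: of_nat_eq_iff) simp
      then show ?thesis by simp
    qed
    ultimately show ?thesis by (simp add: c'_def)
  qed
  have "c b = 0"
  proof -
    have "(\<Sum>d\<in>insert b K. c d * monom_val (\<lambda>_. 1) d) = 0" using insert.prems(1) by blast
    then show ?thesis using insert.hyps * by (simp add: monom_val_def)
  qed
  with * insert.prems(2) show ?case by blast
qed simp

lemma cpoly_eqI:
  assumes "\<And>X. ev f X = ev g X"
  shows "f = g"
proof -
  have "\<forall>X. (\<Sum>a\<in>Poly_Mapping.keys (f - g). Poly_Mapping.lookup (f - g) a * monom_val X a) = 0"
    using assms by (simp flip: ev_def)
  then have "Poly_Mapping.lookup (f - g) a = 0" if "a \<in> Poly_Mapping.keys (f - g)" for a
    using monom_val_independent[OF finite_keys] that by blast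
  then have "Poly_Mapping.lookup (f - g) a = 0" for a
    by (meson in_keys_iff)
  then have "f - g = 0" by (intro poly_mapping_eqI) simp
  then show ?thesis by simp
qed

lemma ev_cong_vars:
  assumes "\<And>a. a \<in> Poly_Mapping.keys f \<Longrightarrow> Poly_Mapping.keys a \<subseteq> V"
    and "\<And>v. v \<in> V \<Longrightarrow> X v = Y v"
  shows "ev f X = ev f Y"
  unfolding ev_def monom_val_def
  by (intro sum.cong prod.cong refl arg_cong2[of _ _ _ _ "(*)"]) (metis assms subsetD)

section \<open>Restriction to lines\<close>

text \<open>The function \<open>t \<mapsto> f (X + t Y)\<close> as a univariate polynomial. Differential equations along a line
  become identities in \<open>complex poly\<close>, where comparing coefficients replaces analysis.\<close>

definition line :: "cpoly \<Rightarrow> (nat \<times> nat \<Rightarrow> complex) \<Rightarrow> (nat \<times> nat \<Rightarrow> complex) \<Rightarrow> complex poly" where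
  "line f X Y = (\<Sum>a\<in>Poly_Mapping.keys f. smult (Poly_Mapping.lookup f a)
     (monom_val (\<lambda>v. [:X v, Y v:]) a))"

lemma poly_line: "poly (line f X Y) t = ev f (\<lambda>v. X v + t * Y v)"
  by (simp add: line_def ev_def monom_val_def poly_sum poly_prod)

text \<open>The product rule. Factors outside \<open>S\<close> are constant along the line, which leaves a finite sum.\<close>

lemma pderiv_monom_val:
  assumes "finite S" "\<And>v. v \<notin> S \<Longrightarrow> Y v = 0"
  shows "pderiv (monom_val (\<lambda>v. [:X v, Y v:]) a) = (\<Sum>v\<in>S. smult (of_nat (Poly_Mapping.lookup a v) * Y v)
    (monom_val (\<lambda>v. [:X v, Y v:]) (a - Poly_Mapping.single v 1)))"
proof -
  define T where "T = S \<union> Poly_Mapping.keys a"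
  define L where "L v = [:X v, Y v:]" for v
  have T: "finite T" "Poly_Mapping.keys a \<subseteq> T" "S \<subseteq> T"
    using assms(1) by (auto simp: T_def)
  have keys: "Poly_Mapping.keys (a - Poly_Mapping.single v 1) \<subseteq> T" for v
    using T(2) by (auto simp: in_keys_iff lookup_minus)
  have summand: "(\<Prod>u\<in>T - {v}. L u ^ Poly_Mapping.lookup a u) * pderiv (L v ^ Poly_Mapping.lookup a v)
      = smult (of_nat (Poly_Mapping.lookup a v) * Y v) (monom_val L (a - Poly_Mapping.single v 1))"
    if v: "v \<in> T" for v
  proof -
    have "monom_val L (a - Poly_Mapping.single v 1)
        = (\<Prod>u\<in>T. L u ^ Poly_Mapping.lookup (a - Poly_Mapping.single v 1) u)"
      by (rule monom_val_superset[OF T(1) keys])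
    also have "\<dots> = L v ^ (Poly_Mapping.lookup a v - 1)
        * (\<Prod>u\<in>T - {v}. L u ^ Poly_Mapping.lookup (a - Poly_Mapping.single v 1) u)"
      using T(1) v by (simp add: prod.remove lookup_minus)
    also have "(\<Prod>u\<in>T - {v}. L u ^ Poly_Mapping.lookup (a - Poly_Mapping.single v 1) u)
        = (\<Prod>u\<in>T - {v}. L u ^ Poly_Mapping.lookup a u)"
      by (rule prod.cong) (auto simp: lookup_minus lookup_single)
    finally have "monom_val L (a - Poly_Mapping.single v 1) = L v ^ (Poly_Mapping.lookup a v - 1)
        * (\<Prod>u\<in>T - {v}. L u ^ Poly_Mapping.lookup a u)" .
    moreover have "pderiv (L v) = [:Y v:]" by (simp add: L_def pderiv_pCons)
    ultimately show ?thesis by (simp add: pderiv_power mult_ac)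
  qed
  have "pderiv (monom_val L a) = pderiv (\<Prod>u\<in>T. L u ^ Poly_Mapping.lookup a u)"
    using T by (simp add: monom_val_superset)
  also have "\<dots> = (\<Sum>v\<in>T. smult (of_nat (Poly_Mapping.lookup a v) * Y v)
      (monom_val L (a - Poly_Mapping.single v 1)))"
    unfolding pderiv_prod by (rule sum.cong[OF refl summand])
  also have "\<dots> = (\<Sum>v\<in>S. smult (of_nat (Poly_Mapping.lookup a v) * Y v)
      (monom_val L (a - Poly_Mapping.single v 1)))"
    by (rule sum.mono_neutral_right) (use T assms(2) in auto)
  finally show ?thesis unfolding L_def .
qed

lemma ev_cpoly_deriv:
  "ev (cpoly_deriv i l f) X = (\<Sum>a\<in>Poly_Mapping.keys f. of_nat (Poly_Mapping.lookup a (i, l))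
    * Poly_Mapping.lookup f a * monom_val X (a - Poly_Mapping.single (i, l) 1))"
  by (simp add: cpoly_deriv_def)

lemma pderiv_sum: "pderiv (\<Sum>i\<in>I. q i) = (\<Sum>i\<in>I. pderiv (q i))"
  by (induction I rule: infinite_finite_induct) (simp_all add: pderiv_add)

text \<open>The chain rule; only the partial derivatives in directions of the support of \<open>Y\<close> contribute.\<close>

lemma poly_pderiv_line:
  assumes "finite S" "\<And>v. v \<notin> S \<Longrightarrow> Y v = 0"
  shows "poly (pderiv (line f X Y)) t
    = (\<Sum>v\<in>S. Y v * ev (cpoly_deriv (fst v) (snd v) f) (\<lambda>u. X u + t * Y u))"
proof -
  have poly_mv: "poly (monom_val (\<lambda>v. [:X v, Y v:]) b) t = monom_val (\<lambda>u. X u + t * Y u) b" for b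
    by (simp add: monom_val_def poly_prod)
  have "poly (pderiv (line f X Y)) t = (\<Sum>a\<in>Poly_Mapping.keys f. \<Sum>v\<in>S.
      Y v * (of_nat (Poly_Mapping.lookup a v) * Poly_Mapping.lookup f a
        * monom_val (\<lambda>u. X u + t * Y u) (a - Poly_Mapping.single v 1)))"
    by (simp add: line_def pderiv_sum pderiv_smult pderiv_monom_val[OF assms] poly_sum poly_mv
      sum_distrib_left mult_ac)
  also have "\<dots> = (\<Sum>v\<in>S. Y v * ev (cpoly_deriv (fst v) (snd v) f) (\<lambda>u. X u + t * Y u))"
    by (subst sum.swap) (simp add: ev_cpoly_deriv sum_distrib_left)
  finally show ?thesis .
qed

section \<open>Polarization operators and their one-parameter groups\<close>

text \<open>The matrix units of \<open>gl(p)\<close> and \<open>gl(m)\<close> act on polynomials in the even variables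
  in this form: \<open>E\<^sub>i\<^sub>j\<close> of \<open>gl(p)\<close> has \<open>S\<close> equal to row \<open>j\<close> and
  a \<open>\<sigma>\<close> that moves it to row \<open>i\<close>, and \<open>E\<^sub>s\<^sub>t\<close> of \<open>gl(m)\<close> does the same with columns.\<close>

definition polar :: "(nat \<times> nat) set \<Rightarrow> (nat \<times> nat \<Rightarrow> nat \<times> nat) \<Rightarrow> cpoly \<Rightarrow> cpoly" where
  "polar S \<sigma> f = (\<Sum>v\<in>S. evar (fst (\<sigma> v)) (snd (\<sigma> v)) * cpoly_deriv (fst v) (snd v) f)"

text \<open>The flow of \<open>polar S \<sigma>\<close> on the space of points if \<open>\<sigma>\<close> maps \<open>S\<close> out of \<open>S\<close>. For the identity \<open>\<sigma>\<close>
  the flow is \<open>scale S\<close> below, with a multiplicative parameter.\<close>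

definition shift ::
  "(nat \<times> nat) set \<Rightarrow> (nat \<times> nat \<Rightarrow> nat \<times> nat) \<Rightarrow> complex \<Rightarrow> (nat \<times> nat \<Rightarrow> complex) \<Rightarrow> nat \<times> nat \<Rightarrow> complex"
  where "shift S \<sigma> t X v = (if v \<in> S then X v + t * X (\<sigma> v) else X v)"

definition scale ::
  "(nat \<times> nat) set \<Rightarrow> complex \<Rightarrow> (nat \<times> nat \<Rightarrow> complex) \<Rightarrow> nat \<times> nat \<Rightarrow> complex"
  where "scale S c X v = (if v \<in> S then c * X v else X v)"

lemma ev_polar:
  "ev (polar S \<sigma> f) X = (\<Sum>v\<in>S. X (\<sigma> v) * ev (cpoly_deriv (fst v) (snd v) f) X)"
  by (simp add: polar_def)

text \<open>The derivative of \<open>f\<close> along the orbit of \<open>X\<close> at time \<open>t\<close> is the value of \<open>polar S \<sigma> f\<close> at the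
  point reached, because the source coordinates do not move.\<close>

lemma polar_eq_0_iff_shift_invariant:
  assumes "finite S" "\<And>v. v \<in> S \<Longrightarrow> \<sigma> v \<notin> S"
  shows "polar S \<sigma> f = 0 \<longleftrightarrow> (\<forall>t X. ev f (shift S \<sigma> t X) = ev f X)"
proof -
  define Y where "Y X v = (if v \<in> S then X (\<sigma> v) else (0::complex))" for X v
  have Y0: "Y X v = 0" if "v \<notin> S" for X v using that by (simp add: Y_def)
  have line': "poly (pderiv (line f Z (Y X))) t
      = (\<Sum>v\<in>S. Y X v * ev (cpoly_deriv (fst v) (snd v) f) (\<lambda>u. Z u + t * Y X u))" for X Z t
    by (rule poly_pderiv_line[OF assms(1)]) (rule Y0)
  have shift: "(\<lambda>v. X v + t * Y X v) = shift S \<sigma> t X" for X t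
    by (auto simp: fun_eq_iff shift_def Y_def)
  have der: "poly (pderiv (line f X (Y X))) t = ev (polar S \<sigma> f) (shift S \<sigma> t X)" for X t
    unfolding line' shift ev_polar
    by (rule sum.cong) (use assms(2) in \<open>auto simp: Y_def shift_def\<close>)
  show ?thesis
  proof
    assume "polar S \<sigma> f = 0"
    then have "pderiv (line f X (Y X)) = 0" for X
      using der by (intro poly_ext) simp
    then have "poly (line f X (Y X)) t = poly (line f X (Y X)) 0" for X t
      using pderiv_iszero[of "line f X (Y X)"] by auto
    then show "\<forall>t X. ev f (shift S \<sigma> t X) = ev f X"
      by (simp add: poly_line shift)
  next
    assume inv: "\<forall>t X. ev f (shift S \<sigma> t X) = ev f X"
    show "polar S \<sigma> f = 0"
    proof (rule cpoly_eqI)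
      fix X
      have "line f X (Y X) = [:ev f X:]"
        by (rule poly_ext) (simp add: poly_line shift inv)
      then have "ev (polar S \<sigma> f) (shift S \<sigma> 0 X) = 0"
        using der[of X 0] by simp
      moreover have "shift S \<sigma> 0 X = X" by (simp add: shift_def fun_eq_iff)
      ultimately show "ev (polar S \<sigma> f) X = ev 0 X" by simp
    qed
  qed
qed

text \<open>On the orbit of a point, \<open>f\<close> is a univariate polynomial \<open>q\<close> and the eigenvalue equation reads
  \<open>t q'(t) = c q(t)\<close>. Comparing coefficients shows that a nonzero solution is a monomial \<open>t\<^sup>k\<close> with
  \<open>c = k\<close>, so weights are natural numbers.\<close>

lemma polar_eigen_iff_scale:
  assumes "finite S" "f \<noteq> 0"
  shows "polar S (\<lambda>v. v) f = Poly_Mapping.single 0 c * f \<longleftrightarrow>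
    (\<exists>k. c = of_nat k \<and> (\<forall>t X. ev f (scale S t X) = t ^ k * ev f X))"
proof -
  \<comment> \<open>The line through the orbit starts where the scaled coordinates vanish, so that \<open>t\<close> is the scaling factor.\<close>
  define Z where "Z X v = (if v \<in> S then 0 else X v :: complex)" for X v
  define Y where "Y X v = (if v \<in> S then X v else (0::complex))" for X v
  have Y0: "Y X v = 0" if "v \<notin> S" for X v using that by (simp add: Y_def)
  have line': "poly (pderiv (line f Z (Y X))) t
      = (\<Sum>v\<in>S. Y X v * ev (cpoly_deriv (fst v) (snd v) f) (\<lambda>u. Z u + t * Y X u))" for X Z t
    by (rule poly_pderiv_line[OF assms(1)]) (rule Y0)
  have scale: "(\<lambda>v. Z X v + t * Y X v) = scale S t X" for X t
    by (auto simp: fun_eq_iff scale_def Y_def Z_def)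
  have scale1: "scale S 1 X = X" for X by (simp add: scale_def fun_eq_iff)
  define q where "q X = line f (Z X) (Y X)" for X
  have q: "poly (q X) t = ev f (scale S t X)" for X t
    by (simp add: q_def poly_line scale)
  have der: "t * poly (pderiv (q X)) t = ev (polar S (\<lambda>v. v) f) (scale S t X)" for X t
    unfolding q_def line' scale ev_polar sum_distrib_left
    by (rule sum.cong) (auto simp: Y_def scale_def)
  show ?thesis
  proof
    assume eig: "polar S (\<lambda>v. v) f = Poly_Mapping.single 0 c * f"
    have "[:0, 1:] * pderiv (q X) = smult c (q X)" for X
      by (rule poly_ext) (simp add: der eig q)
    then have coeff_eq: "coeff ([:0, 1:] * pderiv (q X)) j = c * coeff (q X) j" for X j by simp
    have coeffs: "of_nat j * coeff (q X) j = c * coeff (q X) j" for X j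
      using coeff_eq[of X j] by (cases j) (simp_all add: coeff_pderiv)
    obtain X0 where X0: "ev f X0 \<noteq> 0"
      using assms(2) cpoly_eqI[of f 0] by auto
    then have "poly (q X0) 1 \<noteq> 0" by (simp add: q scale1)
    then obtain k where "coeff (q X0) k \<noteq> 0" by (metis leading_coeff_0_iff poly_0)
    then have ck: "c = of_nat k" using coeffs[of k X0] by simp
    have "q X = monom (coeff (q X) k) k" for X
    proof (rule poly_eqI)
      fix j show "coeff (q X) j = coeff (monom (coeff (q X) k) k) j"
        using coeffs[of j X] by (cases "j = k") (auto simp: ck)
    qed
    then have "poly (q X) t = coeff (q X) k * t ^ k" for X t
      by (metis poly_monom)
    then have "poly (q X) t = poly (q X) 1 * t ^ k" for X t
      by (metis mult.right_neutral power_one)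
    then have "ev f (scale S t X) = t ^ k * ev f X" for X t
      by (simp add: q scale1 mult.commute)
    with ck show "\<exists>k. c = of_nat k \<and> (\<forall>t X. ev f (scale S t X) = t ^ k * ev f X)" by blast
  next
    assume "\<exists>k. c = of_nat k \<and> (\<forall>t X. ev f (scale S t X) = t ^ k * ev f X)"
    then obtain k where ck: "c = of_nat k" and sc: "\<And>t X. ev f (scale S t X) = t ^ k * ev f X" by blast
    show "polar S (\<lambda>v. v) f = Poly_Mapping.single 0 c * f"
    proof (rule cpoly_eqI)
      fix X
      have "q X = monom (ev f X) k"
        by (rule poly_ext) (simp add: q sc poly_monom)
      then have "poly (pderiv (q X)) 1 = of_nat k * ev f X"
        by (simp add: pderiv_monom poly_monom)
      then show "ev (polar S (\<lambda>v. v) f) X = ev (Poly_Mapping.single 0 c * f) X"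
        using der[of 1 X] by (simp add: scale1 ck)
    qed
  qed
qed

section \<open>Leading minors\<close>

text \<open>With variables as entries this is the polynomial in \<open>Delta r\<close>, with numbers as entries it is
  the value of that polynomial.\<close>

definition minor :: "nat \<Rightarrow> (nat \<times> nat \<Rightarrow> 'b::comm_ring_1) \<Rightarrow> 'b" where
  "minor r X = det (mat r r (\<lambda>(i, l). X (Suc i, Suc l)))"

abbreviation minor_poly :: "nat \<Rightarrow> cpoly" where
  "minor_poly r \<equiv> minor r (\<lambda>(i, l). evar i l)"

lemma Delta_eq: "Delta r = of_cpoly (minor_poly r)"
  by (simp add: Delta_def minor_def)

lemma ev_minor_poly: "ev (minor_poly r) X = minor r X"
proof -
  have "map_mat (\<lambda>f. ev f X) (mat r r (\<lambda>(i, l). evar (Suc i) (Suc l)))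
      = mat r r (\<lambda>(i, l). X (Suc i, Suc l))"
    by (rule eq_matI) auto
  moreover have "ev (det (mat r r (\<lambda>(i, l). evar (Suc i) (Suc l)))) X
      = det (map_mat (\<lambda>f. ev f X) (mat r r (\<lambda>(i, l). evar (Suc i) (Suc l))))"
    by (rule ev_hom.hom_det[symmetric])
  ultimately show ?thesis by (simp add: minor_def)
qed

lemma minor_cong:
  assumes "\<And>i l. i \<in> {1..r} \<Longrightarrow> l \<in> {1..r} \<Longrightarrow> X (i, l) = Y (i, l)"
  shows "minor r X = minor r Y"
  unfolding minor_def by (rule arg_cong[of _ _ det]) (rule eq_matI, use assms in auto)

lemma minor_transpose: "minor r (\<lambda>(i, l). X (l, i)) = minor r X"
proof -
  have "mat r r (\<lambda>(i, l). X (Suc l, Suc i)) = transpose_mat (mat r r (\<lambda>(i, l). X (Suc i, Suc l)))"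
    by (rule eq_matI) auto
  then show ?thesis
    unfolding minor_def by (simp add: det_transpose[of _ r])
qed

lemma minor_diagonal:
  assumes "\<And>i l. i \<in> {1..r} \<Longrightarrow> l \<in> {1..r} \<Longrightarrow> i \<noteq> l \<Longrightarrow> X (i, l) = 0"
  shows "minor r X = (\<Prod>i\<in>{1..r}. X (i, i))"
proof -
  let ?M = "mat r r (\<lambda>(i, l). X (Suc i, Suc l))"
  have "det ?M = prod_list (diag_mat ?M)"
    by (rule det_upper_triangular[of _ r]) (use assms in auto)
  also have "\<dots> = (\<Prod>i<r. X (Suc i, Suc i))"
    by (simp add: prod_list_diag_prod lessThan_atLeast0)
  also have "\<dots> = (\<Prod>i\<in>{1..r}. X (i, i))"
    by (rule prod.reindex_bij_witness[of _ "\<lambda>i. i - 1" Suc]) auto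
  finally show ?thesis by (simp add: minor_def)
qed

section \<open>Row and column operations\<close>

definition row_add :: "nat \<Rightarrow> nat \<Rightarrow> nat \<Rightarrow> complex \<Rightarrow> (nat \<times> nat \<Rightarrow> complex) \<Rightarrow> nat \<times> nat \<Rightarrow> complex" where
  "row_add m i j = shift ({i} \<times> {1..m}) (\<lambda>v. (j, snd v))"

definition col_add :: "nat \<Rightarrow> nat \<Rightarrow> nat \<Rightarrow> complex \<Rightarrow> (nat \<times> nat \<Rightarrow> complex) \<Rightarrow> nat \<times> nat \<Rightarrow> complex" where
  "col_add p s t = shift ({1..p} \<times> {s}) (\<lambda>v. (fst v, t))"

lemma row_add_apply:
  "row_add m i j c X (a, b) = (if a = i \<and> b \<in> {1..m} then X (a, b) + c * X (j, b) else X (a, b))"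
  by (simp add: row_add_def shift_def)

lemma col_add_apply:
  "col_add p s t c X (a, b) = (if a \<in> {1..p} \<and> b = s then X (a, b) + c * X (a, t) else X (a, b))"
  by (simp add: col_add_def shift_def)

text \<open>Invariance under the unipotent groups generated by the simple root vectors of \<open>gl(p)\<close> and \<open>gl(m)\<close>.
  It is a property of arbitrary functions on matrices, so that one reduction of a matrix can be
  read off simultaneously by a polynomial and by the leading minors.\<close>

definition unip_invariant :: "nat \<Rightarrow> nat \<Rightarrow> ((nat \<times> nat \<Rightarrow> complex) \<Rightarrow> complex) \<Rightarrow> bool" where
  "unip_invariant p m \<phi> \<longleftrightarrow>
     (\<forall>i\<in>{1<..p}. \<forall>c X. \<phi> (row_add m i (i - 1) c X) = \<phi> X) \<and>
     (\<forall>s\<in>{1<..m}. \<forall>c X. \<phi> (col_add p s (s - 1) c X) = \<phi> X)"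

text \<open>An operation between distant rows is a commutator of operations between closer rows.\<close>

lemma unip_invariant_row_add:
  assumes "unip_invariant p m \<phi>" "1 \<le> j" "j < i" "i \<le> p"
  shows "\<phi> (row_add m i j c X) = \<phi> X"
proof -
  have adj: "\<phi> (row_add m (Suc k) k c X) = \<phi> X" if "1 \<le> k" "Suc k \<le> p" for k c X
    using assms(1) that unfolding unip_invariant_def by (auto dest!: bspec[of _ _ "Suc k"])
  have "Suc j \<le> i" using assms by simp
  then show ?thesis using assms(4)
  proof (induction i arbitrary: c X rule: dec_induct)
    case base
    with assms adj show ?case by simp
  next
    case (step k)
    have k: "1 \<le> k" "Suc k \<le> p" "j < k" using step assms by auto
    have "row_add m (Suc k) j c X
        = row_add m (Suc k) k (-1) (row_add m k j (- c) (row_add m (Suc k) k 1 (row_add m k j c X)))"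
      using k by (auto simp: fun_eq_iff row_add_apply)
    then show ?case
      using step.IH k adj by simp
  qed
qed

lemma unip_invariant_col_add:
  assumes "unip_invariant p m \<phi>" "1 \<le> t" "t < s" "s \<le> m"
  shows "\<phi> (col_add p s t c X) = \<phi> X"
proof -
  have adj: "\<phi> (col_add p (Suc k) k c X) = \<phi> X" if "1 \<le> k" "Suc k \<le> m" for k c X
    using assms(1) that unfolding unip_invariant_def by (auto dest!: bspec[of _ _ "Suc k"])
  have "Suc t \<le> s" using assms by simp
  then show ?thesis using assms(4)
  proof (induction s arbitrary: c X rule: dec_induct)
    case base
    with assms adj show ?case by simp
  next
    case (step k)
    have k: "1 \<le> k" "Suc k \<le> m" "t < k" using step assms by auto
    have "col_add p (Suc k) t c X
        = col_add p (Suc k) k (-1) (col_add p k t (- c) (col_add p (Suc k) k 1 (col_add p k t c X)))"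
      using k by (auto simp: fun_eq_iff col_add_apply)
    then show ?case using step.IH k adj by simp
  qed
qed

text \<open>If a row belongs to the leading \<open>r \<times> r\<close> block, then so does the row above it that is added.\<close>

lemma minor_row_add:
  assumes "1 \<le> j" "j < i" "r \<le> m"
  shows "minor r (row_add m i j c X) = minor r X"
proof (cases "i \<le> r")
  case True
  have "mat r r (\<lambda>(a, b). row_add m i j c X (Suc a, Suc b))
      = addrow c (i - 1) (j - 1) (mat r r (\<lambda>(a, b). X (Suc a, Suc b)))"
    using assms True by (intro eq_matI) (auto simp: row_add_apply)
  then show ?thesis
    unfolding minor_def using assms True by (simp add: det_addrow[of _ r])
next
  case False
  then show ?thesis by (intro minor_cong) (auto simp: row_add_apply)
qed

lemma minor_col_add:
  assumes "1 \<le> t" "t < s" "r \<le> p"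
  shows "minor r (col_add p s t c X) = minor r X"
proof -
  have "(\<lambda>(i, l). col_add p s t c X (l, i)) = row_add p s t c (\<lambda>(i, l). X (l, i))"
    by (auto simp: fun_eq_iff row_add_apply col_add_apply)
  then have "minor r (\<lambda>(i, l). col_add p s t c X (l, i)) = minor r (\<lambda>(i, l). X (l, i))"
    using minor_row_add[OF assms] by simp
  then show ?thesis by (simp add: minor_transpose)
qed

lemma unip_invariant_minor:
  assumes "r \<le> p" "r \<le> m"
  shows "unip_invariant p m (minor r)"
  unfolding unip_invariant_def using assms by (auto intro!: minor_row_add minor_col_add)

lemma minor_scale_row:
  assumes "r \<le> m" "1 \<le> i"
  shows "minor r (scale ({i} \<times> {1..m}) c X) = (if i \<le> r then c else 1) * minor r X"
proof (cases "i \<le> r")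
  case True
  have "mat r r (\<lambda>(a, b). scale ({i} \<times> {1..m}) c X (Suc a, Suc b))
      = multrow (i - 1) c (mat r r (\<lambda>(a, b). X (Suc a, Suc b)))"
    using assms True by (intro eq_matI) (auto simp: scale_def)
  then show ?thesis
    unfolding minor_def using assms True by (simp add: det_multrow[of _ r])
next
  case False
  then show ?thesis by (simp, intro minor_cong) (auto simp: scale_def)
qed

lemma minor_scale_col:
  assumes "r \<le> p" "1 \<le> s"
  shows "minor r (scale ({1..p} \<times> {s}) c X) = (if s \<le> r then c else 1) * minor r X"
proof -
  have "(\<lambda>(i, l). scale ({1..p} \<times> {s}) c X (l, i)) = scale ({s} \<times> {1..p}) c (\<lambda>(i, l). X (l, i))"
    by (auto simp: fun_eq_iff scale_def)
  then have "minor r (\<lambda>(i, l). scale ({1..p} \<times> {s}) c X (l, i))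
      = (if s \<le> r then c else 1) * minor r (\<lambda>(i, l). X (l, i))"
    using minor_scale_row[OF assms] by simp
  then show ?thesis by (simp add: minor_transpose)
qed

section \<open>Elimination\<close>

text \<open>The columns in \<open>L\<close> are changed at once; since column \<open>t\<close> itself stays fixed, this is a sequence
  of single operations.\<close>

lemma unip_invariant_clear_cols:
  assumes "unip_invariant p m \<phi>" "1 \<le> t" "finite L" "L \<subseteq> {t<..m}"
  shows "\<phi> (\<lambda>(i, l). if i \<in> {1..p} \<and> l \<in> L then X (i, l) + \<tau> l * X (i, t) else X (i, l)) = \<phi> X"
  using assms(3,4)
proof (induction L rule: finite_induct)
  case (insert s L)
  let ?Y = "\<lambda>L (i, l). if i \<in> {1..p} \<and> l \<in> L then X (i, l) + \<tau> l * X (i, t) else X (i, l)"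
  have "?Y (insert s L) = col_add p s t (\<tau> s) (?Y L)"
    using insert.hyps insert.prems by (auto simp: fun_eq_iff col_add_apply)
  then have "\<phi> (?Y (insert s L)) = \<phi> (?Y L)"
    using unip_invariant_col_add[OF assms(1,2)] insert.prems by simp
  with insert show ?case by simp
qed simp

lemma unip_invariant_clear_rows:
  assumes "unip_invariant p m \<phi>" "1 \<le> j" "finite I" "I \<subseteq> {j<..p}"
  shows "\<phi> (\<lambda>(i, l). if i \<in> I \<and> l \<in> {1..m} then X (i, l) + \<tau> i * X (j, l) else X (i, l)) = \<phi> X"
  using assms(3,4)
proof (induction I rule: finite_induct)
  case (insert s I)
  let ?Y = "\<lambda>I (i, l). if i \<in> I \<and> l \<in> {1..m} then X (i, l) + \<tau> i * X (j, l) else X (i, l)"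
  have "?Y (insert s I) = row_add m s j (\<tau> s) (?Y I)"
    using insert.hyps insert.prems by (auto simp: fun_eq_iff row_add_apply)
  then have "\<phi> (?Y (insert s I)) = \<phi> (?Y I)"
    using unip_invariant_row_add[OF assms(1,2)] insert.prems by simp
  with insert show ?case by simp
qed simp

text \<open>Two matrices that no invariant function separates. This is all that is needed of two matrices
  that differ by row and column operations, and it is transitive by definition.\<close>

definition unip_equivalent ::
  "nat \<Rightarrow> nat \<Rightarrow> (nat \<times> nat \<Rightarrow> complex) \<Rightarrow> (nat \<times> nat \<Rightarrow> complex) \<Rightarrow> bool" where
  "unip_equivalent p m X Y \<longleftrightarrow> (\<forall>\<phi>. unip_invariant p m \<phi> \<longrightarrow> \<phi> X = \<phi> Y)"

lemma unip_equivalentD: "unip_equivalent p m X Y \<Longrightarrow> unip_invariant p m \<phi> \<Longrightarrow> \<phi> X = \<phi> Y"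
  by (simp only: unip_equivalent_def)

text \<open>Gaussian elimination without exchanging rows. After \<open>k\<close> steps the leading square block of size
  \<open>k + 1\<close> is diagonal, so its determinant is the product of the pivots; this determinant is a leading
  minor, which is invariant and was nonzero at the start. Hence the next pivot is nonzero.\<close>

lemma generic_diagonalization:
  assumes "p \<le> m" "\<And>r. r \<in> {1..p} \<Longrightarrow> minor r X \<noteq> 0" "k \<le> p"
  shows "\<exists>Y. unip_equivalent p m X Y \<and>
    (\<forall>i\<in>{1..p}. \<forall>l\<in>{1..m}. i \<noteq> l \<and> min i l \<le> k \<longrightarrow> Y (i, l) = 0)"
  using assms(3)
proof (induction k)
  case 0
  show ?case by (rule exI[of _ X]) (auto simp: unip_equivalent_def)
next
  case (Suc k)
  then obtain Y where inv: "unip_equivalent p m X Y"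
    and Y0': "\<forall>i\<in>{1..p}. \<forall>l\<in>{1..m}. i \<noteq> l \<and> min i l \<le> k \<longrightarrow> Y (i, l) = 0"
    using Suc_leD by blast
  have Y0: "Y (i, l) = 0" if "i \<in> {1..p}" "l \<in> {1..m}" "i \<noteq> l" "min i l \<le> k" for i l
    using Y0' that by blast
  define t where "t = Suc k"
  have t: "1 \<le> t" "t \<le> p" using Suc.prems by (auto simp: t_def)
  have "minor t Y = minor t X"
    using unip_equivalentD[OF inv unip_invariant_minor] t assms(1) by simp
  moreover have "minor t Y = (\<Prod>i\<in>{1..t}. Y (i, i))"
    by (rule minor_diagonal, rule Y0) (use t assms(1) in \<open>auto simp: t_def min_def\<close>)
  ultimately have "(\<Prod>i\<in>{1..t}. Y (i, i)) \<noteq> 0" using assms(2)[of t] t by simp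
  then have pivot: "Y (t, t) \<noteq> 0" using t by (simp add: prod_zero_iff)
  define Z where "Z = (\<lambda>(i, l). if i \<in> {1..p} \<and> l \<in> {t<..m}
    then Y (i, l) + (- Y (t, l) / Y (t, t)) * Y (i, t) else Y (i, l))"
  define W where "W = (\<lambda>(i, l). if i \<in> {t<..p} \<and> l \<in> {1..m}
    then Z (i, l) + (- Z (i, t) / Z (t, t)) * Z (t, l) else Z (i, l))"
  \<comment> \<open>\<open>Z\<close> has row \<open>t\<close> cleared; \<open>W\<close> has column \<open>t\<close> cleared as well.\<close>
  have "unip_equivalent p m X W"
    unfolding unip_equivalent_def
  proof (intro allI impI)
    fix \<phi> assume that: "unip_invariant p m \<phi>"
    have "\<phi> Z = \<phi> Y" unfolding Z_def by (rule unip_invariant_clear_cols) (use that t in auto)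
    moreover have "\<phi> W = \<phi> Z" unfolding W_def by (rule unip_invariant_clear_rows) (use that t in auto)
    ultimately show "\<phi> X = \<phi> W" using unip_equivalentD[OF inv that] by simp
  qed
  moreover have "W (i, l) = 0"
    if il: "i \<in> {1..p}" "l \<in> {1..m}" "i \<noteq> l" "min i l \<le> Suc k" for i l
  proof -
    have Ztl: "Z (t, l) = 0" if "l \<noteq> t" "l \<in> {1..m}" for l
    proof (cases "l < t")
      case True
      then have "Y (t, l) = 0" using that t by (intro Y0) (auto simp: t_def)
      with True show ?thesis by (simp add: Z_def)
    next
      case False
      then show ?thesis using that t pivot by (simp add: Z_def)
    qed
    have Zit: "Z (i, t) = Y (i, t)" for i by (simp add: Z_def)
    have "min i l \<le> k \<or> i = t \<and> t < l \<or> l = t \<and> t < i"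
      using il(3,4) unfolding t_def by linarith
    then consider "min i l \<le> k" | "i = t" "t < l" | "l = t" "t < i"
      by blast
    then show ?thesis
    proof cases
      case 1
      have "Z (i, l) = 0"
      proof (cases "i \<in> {1..p} \<and> l \<in> {t<..m}")
        case True
        then have "i \<le> k" using 1 by (auto simp: t_def min_def split: if_splits)
        then have "Y (i, t) = 0" using il t assms(1) by (intro Y0) (auto simp: t_def)
        moreover have "Y (i, l) = 0" using il 1 by (intro Y0) auto
        ultimately show ?thesis by (simp add: Z_def)
      next
        case False
        moreover have "Y (i, l) = 0" using il 1 by (intro Y0) auto
        ultimately show ?thesis by (auto simp add: Z_def)
      qed
      moreover have "i \<in> {t<..p} \<Longrightarrow> Z (t, l) = 0"
        using 1 il by (intro Ztl) (auto simp: t_def min_def split: if_splits)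
      ultimately show ?thesis by (simp add: W_def)
    next
      case 2
      then show ?thesis using il Ztl[of l] by (simp add: W_def)
    next
      case 3
      then show ?thesis using il pivot by (simp add: W_def Zit)
    qed
  qed
  ultimately show ?case by blast
qed

section \<open>Invariant polynomials\<close>

definition vars_in :: "(nat \<times> nat) set \<Rightarrow> cpoly \<Rightarrow> bool" where
  "vars_in V f \<longleftrightarrow> (\<forall>a\<in>Poly_Mapping.keys f. Poly_Mapping.keys a \<subseteq> V)"

lemma vars_in_single: "Poly_Mapping.keys a \<subseteq> V \<Longrightarrow> vars_in V (Poly_Mapping.single a c)"
  by (simp add: vars_in_def)

lemma vars_in_0 [simp]: "vars_in V 0"
  by (simp add: vars_in_def)

lemma vars_in_1 [simp]: "vars_in V 1"
  using vars_in_single[of 0 V 1] by simp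

lemma vars_in_of_int [simp]: "vars_in V (of_int k)"
  using vars_in_single[of 0 V "of_int k"] by simp

lemma vars_in_evar: "(i, l) \<in> V \<Longrightarrow> vars_in V (evar i l)"
  by (simp add: evar_def vars_in_single)

lemma vars_in_add: "vars_in V f \<Longrightarrow> vars_in V g \<Longrightarrow> vars_in V (f + g)"
  using keys_add[of f g] unfolding vars_in_def by blast

lemma vars_in_mult:
  assumes "vars_in V f" "vars_in V g"
  shows "vars_in V (f * g)"
  unfolding vars_in_def
proof
  fix c assume "c \<in> Poly_Mapping.keys (f * g)"
  then obtain a b where "c = a + b" "a \<in> Poly_Mapping.keys f" "b \<in> Poly_Mapping.keys g"
    using keys_mult[of f g] by blast
  then show "Poly_Mapping.keys c \<subseteq> V"
    using assms keys_add[of a b] unfolding vars_in_def by blast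
qed

lemma vars_in_sum: "(\<And>i. i \<in> I \<Longrightarrow> vars_in V (f i)) \<Longrightarrow> vars_in V (\<Sum>i\<in>I. f i)"
  by (induction I rule: infinite_finite_induct) (auto intro: vars_in_add)

lemma vars_in_prod: "(\<And>i. i \<in> I \<Longrightarrow> vars_in V (f i)) \<Longrightarrow> vars_in V (\<Prod>i\<in>I. f i)"
  by (induction I rule: infinite_finite_induct) (auto intro: vars_in_mult)

lemma vars_in_minor_poly: "vars_in ({1..r} \<times> {1..r}) (minor_poly r)"
proof -
  have "\<pi> i < r" if "\<pi> permutes {0..<r}" "i < r" for \<pi> i
    using permutes_in_image[OF that(1), of i] that(2) by simp
  then show ?thesis
    unfolding minor_def det_def
    by (auto intro!: vars_in_sum vars_in_mult vars_in_prod vars_in_evar simp: Suc_le_eq)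
qed

definition diagonal :: "(nat \<Rightarrow> complex) \<Rightarrow> nat \<times> nat \<Rightarrow> complex" where
  "diagonal d = (\<lambda>(i, l). if i = l then d i else 0)"

abbreviation unit_matrix :: "nat \<times> nat \<Rightarrow> complex" where
  "unit_matrix \<equiv> diagonal (\<lambda>_. 1)"

lemma minor_unit_matrix [simp]: "minor r unit_matrix = 1"
  by (subst minor_diagonal) (auto simp: diagonal_def)

lemma reduction_to_diagonal:
  assumes "p \<le> m" "\<And>r. r \<in> {1..p} \<Longrightarrow> minor r X \<noteq> 0"
  shows "\<exists>Y. unip_equivalent p m X Y \<and>
    (\<forall>i\<in>{1..p}. \<forall>l\<in>{1..m}. i \<noteq> l \<longrightarrow> Y (i, l) = 0)"
  using generic_diagonalization[OF assms order_refl] by (simp add: min_le_iff_disj)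

text \<open>The matrices with nonzero leading minors are Zariski dense: multiplying by the product of the
  minors turns generic vanishing into vanishing everywhere, and polynomials over \<open>\<complex>\<close> form an
  integral domain (for which the index pairs are ordered lexicographically).\<close>

lemma generic_vanishing:
  assumes "\<And>X. (\<And>r. r \<in> {1..p} \<Longrightarrow> minor r X \<noteq> 0) \<Longrightarrow> ev h X = 0"
  shows "h = 0"
proof -
  define D where "D = (\<Prod>r\<in>{1..p}. minor_poly r)"
  have evD: "ev D X = (\<Prod>r\<in>{1..p}. minor r X)" for X
    unfolding D_def ev_hom.hom_prod ev_minor_poly ..
  have "h * D = 0"
  proof (rule cpoly_eqI)
    fix X show "ev (h * D) X = ev 0 X"
      using assms[of X] by (cases "\<forall>r\<in>{1..p}. minor r X \<noteq> 0") (auto simp: evD)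
  qed
  moreover have "ev D unit_matrix \<noteq> 0" by (simp add: evD)
  then have "D \<noteq> 0" by auto
  ultimately show ?thesis by simp
qed

text \<open>By \<open>polar_eigen_iff_scale\<close>, homogeneity in the rows and in the columns expresses the weight
  conditions for the Cartan subalgebras of \<open>gl(p)\<close> and \<open>gl(m)\<close>.\<close>

definition row_homogeneous :: "nat \<Rightarrow> nat \<Rightarrow> (nat \<Rightarrow> nat) \<Rightarrow> cpoly \<Rightarrow> bool" where
  "row_homogeneous p m \<alpha> f \<longleftrightarrow>
     (\<forall>i\<in>{1..p}. \<forall>c X. ev f (scale ({i} \<times> {1..m}) c X) = c ^ \<alpha> i * ev f X)"

definition col_homogeneous :: "nat \<Rightarrow> nat \<Rightarrow> (nat \<Rightarrow> nat) \<Rightarrow> cpoly \<Rightarrow> bool" where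
  "col_homogeneous p m \<beta> f \<longleftrightarrow>
     (\<forall>s\<in>{1..m}. \<forall>c X. ev f (scale ({1..p} \<times> {s}) c X) = c ^ \<beta> s * ev f X)"

context
  fixes p m :: nat and f :: cpoly and \<alpha> :: "nat \<Rightarrow> nat"
  assumes pm: "p \<le> m" and vars: "vars_in ({1..p} \<times> {1..m}) f"
    and hom: "row_homogeneous p m \<alpha> f" and inv: "unip_invariant p m (ev f)"
begin

lemma ev_cong_block:
  assumes "\<And>v. v \<in> {1..p} \<times> {1..m} \<Longrightarrow> X v = Y v"
  shows "ev f X = ev f Y"
  by (rule ev_cong_vars[of _ "{1..p} \<times> {1..m}"]) (use vars assms in \<open>auto simp: vars_in_def\<close>)

text \<open>A diagonal matrix arises from the unit matrix by scaling rows.\<close>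

lemma ev_diagonal: "ev f (diagonal d) = (\<Prod>i\<in>{1..p}. d i ^ \<alpha> i) * ev f unit_matrix"
proof -
  have "k \<le> p \<Longrightarrow> ev f (diagonal (\<lambda>i. if i \<in> {1..k} then d i else 1))
      = (\<Prod>i\<in>{1..k}. d i ^ \<alpha> i) * ev f unit_matrix" for k
  proof (induction k)
    case (Suc k)
    have "diagonal (\<lambda>i. if i \<in> {1..Suc k} then d i else 1)
        = scale ({Suc k} \<times> {1..m}) (d (Suc k)) (diagonal (\<lambda>i. if i \<in> {1..k} then d i else 1))"
      using Suc.prems pm by (auto simp: fun_eq_iff diagonal_def scale_def)
    then show ?case
      using Suc hom unfolding row_homogeneous_def by (simp add: mult_ac)
  qed simp
  from this[of p] show ?thesis
    using ev_cong_block[of "diagonal d" "diagonal (\<lambda>i. if i \<in> {1..p} then d i else 1)"]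
    by (auto simp: diagonal_def)
qed

lemma ev_generic_eq_ev_diagonal:
  assumes "unip_equivalent p m X Y"
    and "\<forall>i\<in>{1..p}. \<forall>l\<in>{1..m}. i \<noteq> l \<longrightarrow> Y (i, l) = 0"
  shows "ev f X = (\<Prod>i\<in>{1..p}. Y (i, i) ^ \<alpha> i) * ev f unit_matrix"
proof -
  have "ev f X = ev f Y" by (rule unip_equivalentD[OF assms(1) inv])
  also have "\<dots> = ev f (diagonal (\<lambda>i. Y (i, i)))"
    by (rule ev_cong_block) (use assms(2) in \<open>auto simp: diagonal_def\<close>)
  also have "\<dots> = (\<Prod>i\<in>{1..p}. Y (i, i) ^ \<alpha> i) * ev f unit_matrix"
    by (rule ev_diagonal)
  finally show ?thesis .
qed

end

text \<open>On a generic matrix \<open>f\<close> and \<open>g\<close> take the values that they have on an equivalent diagonal matrix, and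
  there the weight determines them up to their values at the unit matrix.\<close>

lemma weight_space_one_dimensional:
  assumes "p \<le> m"
    and f: "vars_in ({1..p} \<times> {1..m}) f" "row_homogeneous p m \<alpha> f" "unip_invariant p m (ev f)"
    and g: "vars_in ({1..p} \<times> {1..m}) g" "row_homogeneous p m \<alpha> g" "unip_invariant p m (ev g)"
    and "ev g unit_matrix = 1"
  shows "f = Poly_Mapping.single 0 (ev f unit_matrix) * g"
proof -
  have "f - Poly_Mapping.single 0 (ev f unit_matrix) * g = 0"
  proof (rule generic_vanishing[of p])
    fix X :: "nat \<times> nat \<Rightarrow> complex"
    assume generic: "\<And>r. r \<in> {1..p} \<Longrightarrow> minor r X \<noteq> 0"
    obtain Y where Y: "unip_equivalent p m X Y"
      "\<forall>i\<in>{1..p}. \<forall>l\<in>{1..m}. i \<noteq> l \<longrightarrow> Y (i, l) = 0"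
      using reduction_to_diagonal[OF assms(1) generic] by blast
    define d where "d = (\<Prod>i\<in>{1..p}. Y (i, i) ^ \<alpha> i)"
    have "ev f X = d * ev f unit_matrix"
      unfolding d_def by (rule ev_generic_eq_ev_diagonal[OF assms(1) f Y])
    moreover have "ev g X = d"
      using ev_generic_eq_ev_diagonal[OF assms(1) g Y] unfolding assms(8) d_def by (simp only: mult_1_right)
    ultimately show "ev (f - Poly_Mapping.single 0 (ev f unit_matrix) * g) X = 0"
      by (simp only: ev_diff ev_mult ev_single monom_val_0 mult_1_right) (simp only: mult.commute diff_self)
  qed
  then show ?thesis by simp
qed

lemma ev_unit_matrix_nonzero:
  assumes "p \<le> m"
    and f: "vars_in ({1..p} \<times> {1..m}) f" "row_homogeneous p m \<alpha> f" "unip_invariant p m (ev f)"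
    and "f \<noteq> 0"
  shows "ev f unit_matrix \<noteq> 0"
proof
  assume *: "ev f unit_matrix = 0"
  have "f = 0"
  proof (rule generic_vanishing[of p])
    fix X :: "nat \<times> nat \<Rightarrow> complex"
    assume generic: "\<And>r. r \<in> {1..p} \<Longrightarrow> minor r X \<noteq> 0"
    obtain Y where Y: "unip_equivalent p m X Y"
      "\<forall>i\<in>{1..p}. \<forall>l\<in>{1..m}. i \<noteq> l \<longrightarrow> Y (i, l) = 0"
      using reduction_to_diagonal[OF assms(1) generic] by blast
    show "ev f X = 0"
      using ev_generic_eq_ev_diagonal[OF assms(1) f Y] * by simp
  qed
  with assms(5) show False by simp
qed

text \<open>Consider the matrix that agrees with the unit matrix except for the block with rows \<open>(t, 1)\<close> and
  \<open>(1, 0)\<close> in position \<open>i, i + 1\<close>. For \<open>t \<noteq> 0\<close> it reduces to a diagonal matrix with entries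
  \<open>t\<close> and \<open>- 1 / t\<close> there, so that \<open>f\<close> has the value \<open>\<plusminus> t\<^bsup>\<alpha> i - \<alpha> (i + 1)\<^esup> f(1)\<close>. This value
  depends polynomially on \<open>t\<close>, so the exponent cannot be negative.\<close>

lemma weight_decreasing:
  assumes "p \<le> m"
    and f: "vars_in ({1..p} \<times> {1..m}) f" "row_homogeneous p m \<alpha> f" "unip_invariant p m (ev f)"
    and "f \<noteq> 0" "1 \<le> i" "i < p"
  shows "\<alpha> (Suc i) \<le> \<alpha> i"
proof (rule ccontr)
  assume "\<not> \<alpha> (Suc i) \<le> \<alpha> i"
  then have "\<alpha> i < \<alpha> (Suc i)" by simp
  from less_imp_Suc_add[OF this] obtain e where e: "\<alpha> (Suc i) = \<alpha> i + Suc e"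
    by auto
  define B where "B v = (if v \<in> {(i, Suc i), (Suc i, i)} then 1
    else if v \<in> {(i, i), (Suc i, Suc i)} then 0 else unit_matrix v)" for v
  define E where "E v = (if v = (i, i) then 1 else 0 :: complex)" for v
  \<comment> \<open>The matrix is \<open>B + t E\<close>.\<close>
  define q where "q = line f B E"
  have key: "poly q t * t ^ Suc e = (- 1) ^ \<alpha> (Suc i) * ev f unit_matrix" if "t \<noteq> 0" for t
  proof -
    define d where "d j = (if j = i then t else if j = Suc i then - 1 / t else 1)" for j
    define X where "X = (\<lambda>v. B v + t * E v)"
    have "col_add p (Suc i) i (- 1 / t) (row_add m (Suc i) i (- 1 / t) X) = diagonal d"
      using that assms(1,6,7)
      by (auto simp: fun_eq_iff X_def B_def E_def d_def diagonal_def row_add_apply col_add_apply)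
    then have "ev f (diagonal d) = ev f X"
      using unip_invariant_col_add[OF f(3), of i "Suc i"] unip_invariant_row_add[OF f(3), of i "Suc i"]
        assms(1,6,7) by (metis Suc_leI lessI order_trans)
    then have "ev f X = ev f (diagonal d)" ..
    also have "\<dots> = (\<Prod>j\<in>{1..p}. d j ^ \<alpha> j) * ev f unit_matrix"
      by (rule ev_diagonal[OF assms(1) f])
    also have "(\<Prod>j\<in>{1..p}. d j ^ \<alpha> j) = (\<Prod>j\<in>{i, Suc i}. d j ^ \<alpha> j)"
      by (rule prod.mono_neutral_right) (use assms(6,7) in \<open>auto simp: d_def\<close>)
    also have "\<dots> = t ^ \<alpha> i * (- 1 / t) ^ \<alpha> (Suc i)"
      by (simp add: d_def)
    finally have "poly q t = t ^ \<alpha> i * (- 1 / t) ^ \<alpha> (Suc i) * ev f unit_matrix"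
      by (simp add: q_def poly_line X_def)
    moreover have "(- 1 / t) ^ \<alpha> (Suc i) = (- 1) ^ \<alpha> (Suc i) / t ^ \<alpha> (Suc i)"
      by (rule power_divide)
    ultimately have "poly q t * t ^ Suc e
        = (t ^ \<alpha> i * t ^ Suc e) / t ^ \<alpha> (Suc i) * ((- 1) ^ \<alpha> (Suc i) * ev f unit_matrix)"
      by (simp only: mult_ac times_divide_eq_left times_divide_eq_right)
    moreover have "t ^ \<alpha> i * t ^ Suc e = t ^ \<alpha> (Suc i)"
      unfolding e power_add ..
    ultimately show ?thesis using that by simp
  qed
  define C where "C = (- 1) ^ \<alpha> (Suc i) * ev f unit_matrix"
  define P where "P = q * monom 1 (Suc e) - [:C:]"
  have "poly P t = 0" if "t \<noteq> 0" for t
    using key[OF that] by (simp add: P_def C_def poly_monom)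
  then have "- {0} \<subseteq> {t. poly P t = 0}" by auto
  moreover have "infinite (- {0 :: complex})"
    by (simp add: infinite_UNIV_char_0 Compl_eq_Diff_UNIV)
  ultimately have "infinite {t. poly P t = 0}"
    by (rule infinite_super)
  then have "P = 0"
    using poly_roots_finite by blast
  then have "q * monom 1 (Suc e) = [:C:]" by (simp add: P_def)
  then have "poly (q * monom 1 (Suc e)) 0 = poly [:C:] 0" by simp
  then have "C = 0" by (simp add: poly_monom)
  then have "ev f unit_matrix = 0" by (simp add: C_def)
  with ev_unit_matrix_nonzero[OF assms(1) f assms(5)] show False by simp
qed

definition minor_prod :: "nat list \<Rightarrow> cpoly" where
  "minor_prod rs = (\<Prod>r\<leftarrow>rs. minor_poly r)"

lemma minor_prod_simps [simp]:
  "minor_prod [] = 1" "minor_prod (r # rs) = minor_poly r * minor_prod rs"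
  by (simp_all add: minor_prod_def)

lemma minor_prod_append: "minor_prod (rs @ rs') = minor_prod rs * minor_prod rs'"
  by (simp add: minor_prod_def)

lemma ev_minor_prod_unit_matrix: "ev (minor_prod rs) unit_matrix = 1"
  by (induction rs) (simp_all add: ev_minor_poly)

lemma vars_in_minor_prod:
  assumes "p \<le> m" "set rs \<subseteq> {1..p}"
  shows "vars_in ({1..p} \<times> {1..m}) (minor_prod rs)"
  using assms(2)
proof (induction rs)
  case (Cons r rs)
  then have "{1..r} \<times> {1..r} \<subseteq> {1..p} \<times> {1..m}" using assms(1) by auto
  then have "vars_in ({1..p} \<times> {1..m}) (minor_poly r)"
    using vars_in_minor_poly[of r] unfolding vars_in_def by blast
  with Cons show ?case by (simp add: vars_in_mult)
qed simp

lemma unip_invariant_minor_prod: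
  assumes "p \<le> m" "set rs \<subseteq> {1..p}"
  shows "unip_invariant p m (ev (minor_prod rs))"
  using assms(2)
proof (induction rs)
  case (Cons r rs)
  then have "unip_invariant p m (minor r)" using assms(1) by (auto intro: unip_invariant_minor)
  with Cons show ?case by (simp add: unip_invariant_def ev_minor_poly)
qed (simp add: unip_invariant_def)

lemma row_homogeneous_minor_prod:
  assumes "p \<le> m" "set rs \<subseteq> {1..p}"
  shows "row_homogeneous p m (\<lambda>i. length (filter (\<lambda>r. i \<le> r) rs)) (minor_prod rs)"
  using assms(2)
proof (induction rs)
  case (Cons r rs)
  then have "r \<le> m" using assms(1) by auto
  with Cons show ?case by (auto simp: row_homogeneous_def ev_minor_poly minor_scale_row[unfolded One_nat_def])
qed (simp add: row_homogeneous_def)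

lemma col_homogeneous_minor_prod:
  assumes "set rs \<subseteq> {1..p}"
  shows "col_homogeneous p m (\<lambda>s. length (filter (\<lambda>r. s \<le> r) rs)) (minor_prod rs)"
  using assms
proof (induction rs)
  case (Cons r rs)
  then show ?case by (auto simp: col_homogeneous_def ev_minor_poly minor_scale_col[unfolded One_nat_def])
qed (simp add: col_homogeneous_def)

section \<open>Coefficients in the superalgebra\<close>

lemma superpoly_eqI: "(\<And>A. odd_coeff F A = odd_coeff G A) \<Longrightarrow> F = G"
  by (simp add: odd_coeff_inject[symmetric] fun_eq_iff)

lemma odd_coeff_infinite: "infinite A \<Longrightarrow> odd_coeff F A = 0"
  using odd_coeff[of F] by auto

lemma odd_coeff_sum: "odd_coeff (\<Sum>i\<in>I. F i) A = (\<Sum>i\<in>I. odd_coeff (F i) A)"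
  by (induction I rule: infinite_finite_induct)
    (simp_all add: zero_superpoly.rep_eq plus_superpoly.rep_eq)

lemma odd_coeff_of_cpoly_mult: "odd_coeff (of_cpoly f * F) C = f * odd_coeff F C"
proof (cases "finite C")
  case True
  have "odd_coeff (of_cpoly f * F) C
      = (\<Sum>A\<in>{{}}. (- 1) ^ inversions A (C - A) * (if A = {} then f else 0) * odd_coeff F (C - A))"
    unfolding times_superpoly.rep_eq of_cpoly.rep_eq
    by (rule sum.mono_neutral_right) (use True in auto)
  then show ?thesis by simp
qed (simp add: odd_coeff_infinite)

lemma odd_coeff_etavar_mult:
  assumes "finite C"
  shows "odd_coeff (etavar i k * F) C = (if (i, k) \<in> C
    then (- 1) ^ inversions {(i, k)} (C - {(i, k)}) * odd_coeff F (C - {(i, k)}) else 0)"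
proof -
  have "odd_coeff (etavar i k * F) C
      = (\<Sum>A\<in>Pow C. if A = {(i, k)} then (- 1) ^ inversions A (C - A) * odd_coeff F (C - A) else 0)"
    unfolding times_superpoly.rep_eq etavar.rep_eq by (rule sum.cong) auto
  also have "\<dots> = (if {(i, k)} \<in> Pow C
      then (- 1) ^ inversions {(i, k)} (C - {(i, k)}) * odd_coeff F (C - {(i, k)}) else 0)"
    by (rule sum.delta) (use assms in simp)
  finally show ?thesis by simp
qed

lemma cpoly_sign_mult_eq_0: "(- 1) ^ k * f = (0 :: cpoly) \<longleftrightarrow> f = 0"
  by (cases "even k") simp_all

lemma polar_cong: "(\<And>v. v \<in> S \<Longrightarrow> \<sigma> v = \<tau> v) \<Longrightarrow> polar S \<sigma> f = polar S \<tau> f"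
  unfolding polar_def by (rule sum.cong) auto

lemma polar_col: "polar ({1..p} \<times> {t}) (\<lambda>v. (fst v, s)) f = (\<Sum>j\<in>{1..p}. evar j s * cpoly_deriv j t f)"
  unfolding polar_def by (rule sum.reindex_bij_witness[of _ "\<lambda>j. (j, t)" fst]) auto

lemma polar_row: "polar ({j} \<times> {1..m}) (\<lambda>v. (i, snd v)) f = (\<Sum>l\<in>{1..m}. evar i l * cpoly_deriv j l f)"
  unfolding polar_def by (rule sum.reindex_bij_witness[of _ "\<lambda>l. (j, l)" snd]) auto

lemma odd_coeff_glm_op:
  "odd_coeff (glm_op p s t F) A = polar ({1..p} \<times> {t}) (\<lambda>v. (fst v, s)) (odd_coeff F A)"
  by (simp add: glm_op_def odd_coeff_sum xvar_def odd_coeff_of_cpoly_mult dx.rep_eq polar_col[unfolded One_nat_def])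

lemma odd_coeff_glodd_op:
  "odd_coeff (glodd_op p s k F) A = (\<Sum>j\<in>{1..p}. evar j s * odd_coeff (deta j k F) A)"
  by (simp add: glodd_op_def odd_coeff_sum xvar_def odd_coeff_of_cpoly_mult)

section \<open>Highest weight vectors contain no odd variables\<close>

text \<open>The first \<open>p\<close> equations form a square system whose matrix of variables has the nonzero
  determinant \<open>\<Delta>\<^sub>p\<close>.\<close>

lemma generic_square_system:
  assumes "p \<le> m" "\<And>s. s \<in> {1..m} \<Longrightarrow> (\<Sum>j\<in>{1..p}. evar j s * g j) = 0" "j \<in> {1..p}"
  shows "g j = 0"
proof -
  define M where "M = mat p p (\<lambda>(s, j). evar (Suc j) (Suc s))"
  define v where "v = vec p (\<lambda>j. g (Suc j))"
  have M: "M \<in> carrier_mat p p" by (simp add: M_def)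
  have v: "v \<in> carrier_vec p" by (simp add: v_def)
  have "M = transpose_mat (mat p p (\<lambda>(i, l). evar (Suc i) (Suc l)))"
    unfolding M_def by (rule eq_matI) auto
  then have "det M = minor_poly p"
    by (simp add: minor_def det_transpose[of _ p])
  then have "ev (det M) unit_matrix = 1" by (simp add: ev_minor_poly)
  then have "det M \<noteq> 0" by auto
  moreover have "M *\<^sub>v v = 0\<^sub>v p"
  proof (rule eq_vecI)
    fix s assume "s < dim_vec (0\<^sub>v p :: cpoly vec)"
    then have s: "s < p" by simp
    have "(M *\<^sub>v v) $ s = (\<Sum>j<p. evar (Suc j) (Suc s) * g (Suc j))"
      using s by (simp add: M_def v_def scalar_prod_def lessThan_atLeast0)
    also have "\<dots> = (\<Sum>j\<in>{1..p}. evar j (Suc s) * g j)"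
      by (rule sum.reindex_bij_witness[of _ "\<lambda>i. i - 1" Suc]) auto
    also have "\<dots> = 0" using s assms(1) by (intro assms(2)) simp
    finally show "(M *\<^sub>v v) $ s = 0\<^sub>v p $ s" using s by simp
  qed (simp add: M_def)
  ultimately have "v = 0\<^sub>v p"
    using det_0_iff_vec_prod_zero[OF M] v by blast
  then have "v $ (j - 1) = 0\<^sub>v p $ (j - 1)" by simp
  then show ?thesis using assms(3) by (auto simp: v_def)
qed

text \<open>The commutator of the root vectors \<open>x\<^sub>s \<partial>/\<partial>x\<^sub>s\<^sub>+\<^sub>1\<close> and \<open>x\<^sub>s\<^sub>+\<^sub>1 \<partial>/\<partial>\<eta>\<^sub>k\<close> is \<open>x\<^sub>s \<partial>/\<partial>\<eta>\<^sub>k\<close>. In terms of values: the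
  \<open>\<eta>\<^sub>k\<close>-derivatives of \<open>F\<close> are invariant under the flow of the first operator, and applying that
  flow to the relation given by the second one adds the desired relation to it.\<close>

lemma glodd_op_step:
  assumes "glm_op p s (Suc s) F = 0" "glodd_op p (Suc s) k F = 0"
  shows "glodd_op p s k F = 0"
proof (rule superpoly_eqI)
  fix A
  define g where "g j = odd_coeff (deta j k F) A" for j
  let ?S = "{1..p} \<times> {Suc s}"
  let ?\<sigma> = "\<lambda>v :: nat \<times> nat. (fst v, s)"
  have "polar ?S ?\<sigma> (odd_coeff F B) = 0" for B
    using odd_coeff_glm_op[of p s "Suc s" F B] assms(1) by (simp add: zero_superpoly.rep_eq)
  moreover have "(polar ?S ?\<sigma> f = 0) \<longleftrightarrow> (\<forall>t X. ev f (shift ?S ?\<sigma> t X) = ev f X)" for f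
    by (rule polar_eq_0_iff_shift_invariant) auto
  ultimately have inv: "ev (odd_coeff F B) (shift ?S ?\<sigma> t X) = ev (odd_coeff F B) X" for B t X
    by blast
  have g_inv: "ev (g j) (shift ?S ?\<sigma> t X) = ev (g j) X" for j t X
    by (simp add: g_def deta.rep_eq inv[unfolded One_nat_def])
  have zero: "(\<Sum>j\<in>{1..p}. X (j, Suc s) * ev (g j) X) = 0" for X
  proof -
    have "(\<Sum>j\<in>{1..p}. evar j (Suc s) * g j) = 0"
      using odd_coeff_glodd_op[of p "Suc s" k F A] assms(2)
      by (simp add: zero_superpoly.rep_eq g_def)
    then have "ev (\<Sum>j\<in>{1..p}. evar j (Suc s) * g j) X = 0" by simp
    then show ?thesis by simp
  qed
  have "(\<Sum>j\<in>{1..p}. evar j s * g j) = 0"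
  proof (rule cpoly_eqI)
    fix X
    have "0 = (\<Sum>j\<in>{1..p}. shift ?S ?\<sigma> 1 X (j, Suc s) * ev (g j) (shift ?S ?\<sigma> 1 X))"
      by (rule zero[symmetric])
    also have "\<dots> = (\<Sum>j\<in>{1..p}. X (j, Suc s) * ev (g j) X) + (\<Sum>j\<in>{1..p}. X (j, s) * ev (g j) X)"
      unfolding g_inv sum.distrib[symmetric]
      by (rule sum.cong) (auto simp: shift_def distrib_right)
    finally show "ev (\<Sum>j\<in>{1..p}. evar j s * g j) X = ev 0 X"
      by (simp add: zero[unfolded One_nat_def])
  qed
  then show "odd_coeff (glodd_op p s k F) A = odd_coeff 0 A"
    unfolding odd_coeff_glodd_op by (simp add: g_def zero_superpoly.rep_eq)
qed

lemma odd_coeff_eq_0_if_deta: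
  assumes "deta i k F = 0" "(i, k) \<in> A"
  shows "odd_coeff F A = 0"
proof -
  have "odd_coeff (deta i k F) (A - {(i, k)}) = 0"
    using assms(1) by (simp add: zero_superpoly.rep_eq)
  then have "(- 1) ^ inversions {(i, k)} (A - {(i, k)}) * odd_coeff F A = 0"
    using assms(2) by (simp add: deta.rep_eq insert_absorb)
  then show ?thesis by (simp add: cpoly_sign_mult_eq_0)
qed

text \<open>If \<open>F\<close> does not contain the variables \<open>\<eta>\<^sub>k\<close>, then in \<open>\<Sum>\<^sub>j \<eta>\<^sub>k\<^sup>j \<partial>F/\<partial>\<eta>\<^sub>k\<^sub>+\<^sub>1\<^sup>j\<close> every monomial
  contains exactly one of them, which reveals the summand it comes from. So the summands cannot
  cancel each other.\<close>

lemma gln_op_step: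
  assumes "gln_op p k (Suc k) F = 0" "F \<in> superalg p m n"
    and k: "\<And>i A. (i, k) \<in> A \<Longrightarrow> odd_coeff F A = 0"
    and "(i, Suc k) \<in> A"
  shows "odd_coeff F A = 0"
proof (rule ccontr)
  assume nz: "odd_coeff F A \<noteq> 0"
  then have "A \<subseteq> {1..p} \<times> {1..n}" using assms(2) by (auto simp: superalg_def)
  then have i: "i \<in> {1..p}" using assms(4) by auto
  have fin: "finite A" using nz odd_coeff_infinite by blast
  have kA: "(j, k) \<notin> A" for j using nz k by blast
  \<comment> \<open>\<open>C\<close> replaces \<open>\<eta>\<^sub>k\<^sub>+\<^sub>1\<^sup>i\<close> by \<open>\<eta>\<^sub>k\<^sup>i\<close> in \<open>A\<close>; its coefficient in the sum is \<open>\<plusminus>\<close> that of \<open>A\<close> in \<open>F\<close>.\<close>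
  define B where "B = A - {(i, Suc k)}"
  define C where "C = insert (i, k) B"
  have BC: "(i, Suc k) \<notin> B" "insert (i, Suc k) B = A" "finite C" "C - {(i, k)} = B" "(i, k) \<in> C"
    using assms(4) fin kA by (auto simp: B_def C_def)
  have C: "(j, k) \<in> C \<longleftrightarrow> j = i" for j using kA by (auto simp: C_def B_def)
  have "0 = odd_coeff (gln_op p k (Suc k) F) C" using assms(1) by (simp add: zero_superpoly.rep_eq)
  also have "\<dots> = (\<Sum>j\<in>{1..p}. odd_coeff (etavar j k * deta j (Suc k) F) C)"
    by (simp add: gln_op_def odd_coeff_sum)
  also have "\<dots> = (\<Sum>j\<in>{1..p}. if j = i then odd_coeff (etavar i k * deta i (Suc k) F) C else 0)"
    by (rule sum.cong) (auto simp: odd_coeff_etavar_mult[OF BC(3)] C)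
  also have "\<dots> = odd_coeff (etavar i k * deta i (Suc k) F) C"
    using i by simp
  also have "\<dots> = (- 1) ^ inversions {(i, k)} B * ((- 1) ^ inversions {(i, Suc k)} B * odd_coeff F A)"
    using BC by (simp add: odd_coeff_etavar_mult deta.rep_eq)
  finally have "(- 1) ^ (inversions {(i, k)} B + inversions {(i, Suc k)} B) * odd_coeff F A = 0"
    by (simp add: power_add mult.assoc)
  with nz show False by (simp add: cpoly_sign_mult_eq_0)
qed

text \<open>The odd simple root vector and the even ones of \<open>gl(m)\<close> give \<open>\<Sum>\<^sub>j x\<^sub>s\<^sup>j \<partial>F/\<partial>\<eta>\<^sub>1\<^sup>j = 0\<close> for all \<open>s \<le> m\<close>.
  As \<open>m \<ge> p\<close>, this linear system forces \<open>\<partial>F/\<partial>\<eta>\<^sub>1\<^sup>j = 0\<close>, so no \<open>\<eta>\<^sub>1\<^sup>j\<close> occurs in \<open>F\<close>. The simple root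
  vectors of \<open>gl(n)\<close> carry this over to \<open>\<eta>\<^sub>2, \<dots>, \<eta>\<^sub>n\<close>.\<close>

lemma highest_weight_vector_no_odd:
  assumes "p \<le> m" "highest_weight_vector p m n F"
  shows "F = of_cpoly (odd_coeff F {})"
proof -
  have alg: "F \<in> superalg p m n"
    and glm': "\<forall>s\<in>{1<..m}. glm_op p (s - 1) s F = 0"
    and gln': "\<forall>k\<in>{1<..n}. gln_op p (k - 1) k F = 0"
    and odd: "1 \<le> m \<and> 1 \<le> n \<longrightarrow> glodd_op p m 1 F = 0"
    using assms(2) unfolding highest_weight_vector_def by blast+
  have glm: "glm_op p s (Suc s) F = 0" if "1 \<le> s" "Suc s \<le> m" for s
    using bspec[OF glm', of "Suc s"] that by simp
  have gln: "gln_op p k (Suc k) F = 0" if "1 \<le> k" "Suc k \<le> n" for k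
    using bspec[OF gln', of "Suc k"] that by simp
  have first: "odd_coeff F A = 0" if "1 \<le> n" "(i, 1) \<in> A" for i A
  proof (rule ccontr)
    assume nz: "odd_coeff F A \<noteq> 0"
    then have "A \<subseteq> {1..p} \<times> {1..n}" using alg by (auto simp: superalg_def)
    with that have i: "i \<in> {1..p}" by auto
    then have "1 \<le> m" using assms(1) by simp
    have glodd: "glodd_op p s 1 F = 0" if "s \<in> {1..m}" for s
    proof -
      from that have "s \<le> m" by simp
      then show ?thesis
      proof (induction s rule: inc_induct)
        case base
        show ?case using odd \<open>1 \<le> m\<close> \<open>1 \<le> n\<close> by blast
      next
        case (step s')
        then have "1 \<le> s'" "Suc s' \<le> m" using that by simp_all
        then show ?case using glodd_op_step[OF glm step.IH] by blast
      qed
    qed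
    have "deta i 1 F = 0"
    proof (rule superpoly_eqI)
      fix B
      have "odd_coeff (deta i 1 F) B = 0"
      proof (rule generic_square_system[OF assms(1) _ i])
        fix s assume "s \<in> {1..m}"
        then show "(\<Sum>j\<in>{1..p}. evar j s * odd_coeff (deta j 1 F) B) = 0"
          using odd_coeff_glodd_op[of p s 1 F B] glodd by (simp add: zero_superpoly.rep_eq)
      qed
      then show "odd_coeff (deta i 1 F) B = odd_coeff 0 B" by (simp add: zero_superpoly.rep_eq)
    qed
    with nz that(2) odd_coeff_eq_0_if_deta show False by blast
  qed
  have all: "odd_coeff F A = 0" if "1 \<le> k" "k \<le> n" "(i, k) \<in> A" for i k A
    using that
  proof (induction k arbitrary: i A rule: dec_induct)
    case base
    then show ?case using first by simp
  next
    case (step k)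
    then show ?case using gln_op_step[OF gln alg, of k i A] by auto
  qed
  have "odd_coeff F A = 0" if "A \<noteq> {}" for A
  proof (rule ccontr)
    assume nz: "odd_coeff F A \<noteq> 0"
    then have "A \<subseteq> {1..p} \<times> {1..n}" using alg by (auto simp: superalg_def)
    with that obtain i k where "(i, k) \<in> A" "1 \<le> k" "k \<le> n" by fastforce
    with all nz show False by blast
  qed
  then show ?thesis by (intro superpoly_eqI) (auto simp: of_cpoly.rep_eq)
qed

section \<open>The action on polynomials in the even variables\<close>

lemma odd_coeff_of_cpoly: "odd_coeff (of_cpoly f) A = (if A = {} then f else 0)"
  by (simp add: of_cpoly.rep_eq)

lemma of_cpoly_eq_iff: "of_cpoly f = of_cpoly g \<longleftrightarrow> f = g"
  by (metis odd_coeff_of_cpoly)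

lemma of_cpoly_0: "of_cpoly 0 = 0"
  by (rule superpoly_eqI) (simp add: odd_coeff_of_cpoly zero_superpoly.rep_eq)

lemma of_cpoly_1: "of_cpoly 1 = 1"
  by (rule superpoly_eqI) (simp add: odd_coeff_of_cpoly one_superpoly.rep_eq)

lemma of_cpoly_eq_0_iff: "of_cpoly f = 0 \<longleftrightarrow> f = 0"
  by (metis of_cpoly_0 of_cpoly_eq_iff)

lemma of_cpoly_mult: "of_cpoly (f * g) = of_cpoly f * of_cpoly g"
  by (rule superpoly_eqI) (simp add: odd_coeff_of_cpoly_mult odd_coeff_of_cpoly)

lemma smult_super_of_cpoly: "smult_super c (of_cpoly f) = of_cpoly (Poly_Mapping.single 0 c * f)"
  by (rule superpoly_eqI) (simp add: smult_super.rep_eq odd_coeff_of_cpoly)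

lemma deta_of_cpoly: "deta i k (of_cpoly f) = 0"
  by (rule superpoly_eqI) (simp add: deta.rep_eq odd_coeff_of_cpoly zero_superpoly.rep_eq)

lemma glm_op_of_cpoly:
  "glm_op p s t (of_cpoly f) = of_cpoly (polar ({1..p} \<times> {t}) (\<lambda>v. (fst v, s)) f)"
  by (rule superpoly_eqI) (simp add: odd_coeff_glm_op odd_coeff_of_cpoly polar_def cpoly_deriv_def)

lemma glp_op_of_cpoly:
  "glp_op m n i j (of_cpoly f) = of_cpoly (polar ({j} \<times> {1..m}) (\<lambda>v. (i, snd v)) f)"
  by (rule superpoly_eqI)
    (simp add: glp_op_def deta_of_cpoly plus_superpoly.rep_eq zero_superpoly.rep_eq odd_coeff_sum
      xvar_def odd_coeff_of_cpoly_mult dx.rep_eq odd_coeff_of_cpoly polar_row[unfolded One_nat_def] cpoly_deriv_def)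

lemma gln_op_of_cpoly: "gln_op p k l (of_cpoly f) = 0"
  by (simp add: gln_op_def deta_of_cpoly)

lemma glodd_op_of_cpoly: "glodd_op p s k (of_cpoly f) = 0"
  by (simp add: glodd_op_def deta_of_cpoly)

lemma superalg_of_cpoly: "of_cpoly f \<in> superalg p m n \<longleftrightarrow> vars_in ({1..p} \<times> {1..m}) f"
  by (auto simp: superalg_def vars_in_def odd_coeff_of_cpoly split: if_splits)

text \<open>The operators of \<open>gl(n)\<close> vanish on polynomials without odd variables, hence the last condition.\<close>

lemma has_weight_of_cpoly_iff:
  assumes "f \<noteq> 0"
  shows "has_weight p m n (of_cpoly f) a b c \<longleftrightarrow>
    (\<exists>\<alpha>. row_homogeneous p m \<alpha> f \<and> (\<forall>i\<in>{1..p}. a i = of_nat (\<alpha> i))) \<and>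
    (\<exists>\<beta>. col_homogeneous p m \<beta> f \<and> (\<forall>s\<in>{1..m}. b s = of_nat (\<beta> s))) \<and>
    (\<forall>k\<in>{1..n}. c k = 0)"
proof -
  have row: "glp_op m n i i (of_cpoly f) = smult_super (a i) (of_cpoly f) \<longleftrightarrow>
      (\<exists>k. a i = of_nat k \<and> (\<forall>t X. ev f (scale ({i} \<times> {1..m}) t X) = t ^ k * ev f X))" for i
  proof -
    have "polar ({i} \<times> {1..m}) (\<lambda>v. (i, snd v)) f = polar ({i} \<times> {1..m}) (\<lambda>v. v) f"
      by (rule polar_cong) auto
    then show ?thesis
      using polar_eigen_iff_scale[of "{i} \<times> {1..m}" f "a i"] assms
      by (simp add: glp_op_of_cpoly smult_super_of_cpoly of_cpoly_eq_iff)
  qed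
  have col: "glm_op p s s (of_cpoly f) = smult_super (b s) (of_cpoly f) \<longleftrightarrow>
      (\<exists>k. b s = of_nat k \<and> (\<forall>t X. ev f (scale ({1..p} \<times> {s}) t X) = t ^ k * ev f X))" for s
  proof -
    have "polar ({1..p} \<times> {s}) (\<lambda>v. (fst v, s)) f = polar ({1..p} \<times> {s}) (\<lambda>v. v) f"
      by (rule polar_cong) auto
    then show ?thesis
      using polar_eigen_iff_scale[of "{1..p} \<times> {s}" f "b s"] assms
      by (simp add: glm_op_of_cpoly smult_super_of_cpoly of_cpoly_eq_iff)
  qed
  have odd: "gln_op p k k (of_cpoly f) = smult_super (c k) (of_cpoly f) \<longleftrightarrow> c k = 0" for k
  proof -
    have "(0 = smult_super (c k) (of_cpoly f)) \<longleftrightarrow> Poly_Mapping.single 0 (c k) * f = 0"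
      by (metis smult_super_of_cpoly of_cpoly_eq_0_iff)
    also have "\<dots> \<longleftrightarrow> c k = 0"
      using assms by simp (metis lookup_single_eq lookup_zero single_zero)
    finally show ?thesis by (simp add: gln_op_of_cpoly)
  qed
  show ?thesis
    unfolding has_weight_def row col odd row_homogeneous_def col_homogeneous_def
    by (simp only: bchoice_iff) blast
qed

lemma highest_weight_vector_of_cpoly_iff:
  "highest_weight_vector p m n (of_cpoly f) \<longleftrightarrow>
    f \<noteq> 0 \<and> vars_in ({1..p} \<times> {1..m}) f \<and> unip_invariant p m (ev f) \<and>
    (\<exists>\<alpha>. row_homogeneous p m \<alpha> f) \<and> (\<exists>\<beta>. col_homogeneous p m \<beta> f)"
proof (cases "f = 0")
  case True
  then show ?thesis by (simp add: highest_weight_vector_def of_cpoly_0)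
next
  case False
  have row: "glp_op m n (i - 1) i (of_cpoly f) = 0 \<longleftrightarrow> (\<forall>c X. ev f (row_add m i (i - 1) c X) = ev f X)"
    if "i \<in> {1<..p}" for i
    unfolding glp_op_of_cpoly of_cpoly_eq_0_iff row_add_def
    by (rule polar_eq_0_iff_shift_invariant) (use that in auto)
  have col: "glm_op p (s - 1) s (of_cpoly f) = 0 \<longleftrightarrow> (\<forall>c X. ev f (col_add p s (s - 1) c X) = ev f X)"
    if "s \<in> {1<..m}" for s
    unfolding glm_op_of_cpoly of_cpoly_eq_0_iff col_add_def
    by (rule polar_eq_0_iff_shift_invariant) (use that in auto)
  have weight: "(\<exists>a b c. has_weight p m n (of_cpoly f) a b c) \<longleftrightarrow>
      (\<exists>\<alpha>. row_homogeneous p m \<alpha> f) \<and> (\<exists>\<beta>. col_homogeneous p m \<beta> f)"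
  proof (intro iffI conjI)
    assume "(\<exists>\<alpha>. row_homogeneous p m \<alpha> f) \<and> (\<exists>\<beta>. col_homogeneous p m \<beta> f)"
    then obtain \<alpha> \<beta> where "row_homogeneous p m \<alpha> f" "col_homogeneous p m \<beta> f" by blast
    then have "has_weight p m n (of_cpoly f) (\<lambda>i. of_nat (\<alpha> i)) (\<lambda>s. of_nat (\<beta> s)) (\<lambda>_. 0)"
      unfolding has_weight_of_cpoly_iff[OF False] by blast
    then show "\<exists>a b c. has_weight p m n (of_cpoly f) a b c" by blast
  qed (use has_weight_of_cpoly_iff[OF False] in blast)+
  show ?thesis
    unfolding highest_weight_vector_def weight superalg_of_cpoly of_cpoly_eq_0_iff
      unip_invariant_def gln_op_of_cpoly glodd_op_of_cpoly
    using row col by (auto simp: False)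
qed

section \<open>Young diagrams and their columns\<close>

lemma young_diagram_antimono:
  assumes "young_diagram_of_length_le p lam" "1 \<le> i" "i \<le> k"
  shows "lam k \<le> lam i"
  using assms(3)
proof (induction k rule: dec_induct)
  case (step k)
  then have "lam (Suc k) \<le> lam k" using assms(1,2) by (auto simp: young_diagram_of_length_le_def)
  with step.IH show ?case by simp
qed simp

text \<open>The rows of length at least \<open>j\<close> are the first ones, so counting them locates the last of them.\<close>

lemma le_transpose_diagram_iff:
  assumes "young_diagram_of_length_le p lam" "1 \<le> i" "1 \<le> j"
  shows "i \<le> transpose_diagram lam j \<longleftrightarrow> j \<le> lam i"
proof -
  define S where "S = {i. 1 \<le> i \<and> j \<le> lam i}"
  have "S \<subseteq> {1..p}"
  proof
    fix k assume "k \<in> S"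
    then have "lam k \<noteq> 0" "1 \<le> k" using assms(3) by (auto simp: S_def)
    then show "k \<in> {1..p}"
      using assms(1) unfolding young_diagram_of_length_le_def by (metis atLeastAtMost_iff not_le)
  qed
  then have fin: "finite S" by (rule finite_subset) simp
  have down: "k \<in> S" if "k' \<in> S" "1 \<le> k" "k \<le> k'" for k k'
    using that young_diagram_antimono[OF assms(1), of k k'] by (auto simp: S_def)
  show ?thesis
  proof
    assume "j \<le> lam i"
    then have "{1..i} \<subseteq> S" using assms(2) by (auto intro: down[of i] simp: S_def[THEN eqset_imp_iff])
    then show "i \<le> transpose_diagram lam j"
      using card_mono[OF fin, of "{1..i}"] by (simp add: transpose_diagram_def S_def)
  next
    assume le: "i \<le> transpose_diagram lam j"
    show "j \<le> lam i"
    proof (rule ccontr)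
      assume "\<not> j \<le> lam i"
      then have "i \<notin> S" by (simp add: S_def)
      then have "S \<subseteq> {1..<i}" using down assms(2) by (auto simp: S_def not_le[symmetric])
      then have "card S \<le> i - 1" using card_mono[of "{1..<i}" S] by simp
      with le assms(2) show False by (simp add: transpose_diagram_def S_def)
    qed
  qed
qed

lemma transpose_diagram_le:
  assumes "young_diagram_of_length_le p lam" "1 \<le> j"
  shows "transpose_diagram lam j \<le> p"
proof (rule ccontr)
  assume "\<not> transpose_diagram lam j \<le> p"
  then have "j \<le> lam (Suc p)"
    using le_transpose_diagram_iff[OF assms(1) _ assms(2), of "Suc p"] by simp
  then show False using assms by (simp add: young_diagram_of_length_le_def)
qed

definition columns :: "(nat \<Rightarrow> nat) \<Rightarrow> nat list" where
  "columns lam = map (transpose_diagram lam) [1..<Suc (lam 1)]"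

lemma set_columns:
  assumes "young_diagram_of_length_le p lam"
  shows "set (columns lam) \<subseteq> {1..p}"
proof
  fix r assume "r \<in> set (columns lam)"
  then obtain j where j: "1 \<le> j" "j \<le> lam 1" "r = transpose_diagram lam j"
    by (auto simp: columns_def)
  then have "1 \<le> r" using le_transpose_diagram_iff[OF assms, of 1 j] by simp
  then show "r \<in> {1..p}" using transpose_diagram_le[OF assms j(1)] j(3) by simp
qed

text \<open>Row \<open>i\<close> meets the columns of height at least \<open>i\<close>. This count is the exponent with which
  \<open>minor_prod (columns lam)\<close> scales in row \<open>i\<close>, so that product has weight \<open>lam\<close>.\<close>

lemma length_filter_columns:
  assumes "young_diagram_of_length_le p lam" "1 \<le> i"
  shows "length (filter (\<lambda>r. i \<le> r) (columns lam)) = lam i"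
proof -
  have "length (filter (\<lambda>r. i \<le> r) (columns lam))
      = length (filter (\<lambda>j. i \<le> transpose_diagram lam j) [1..<Suc (lam 1)])"
    by (simp add: columns_def filter_map o_def)
  also have "filter (\<lambda>j. i \<le> transpose_diagram lam j) [1..<Suc (lam 1)]
      = filter (\<lambda>j. j \<le> lam i) [1..<Suc (lam 1)]"
    by (rule filter_cong) (use le_transpose_diagram_iff[OF assms] in auto)
  also have "length \<dots> = card {j \<in> {1..lam 1}. j \<le> lam i}"
    by (subst distinct_card[symmetric]) (auto intro!: arg_cong[of _ _ card])
  also have "{j \<in> {1..lam 1}. j \<le> lam i} = {1..lam i}"
    using young_diagram_antimono[OF assms(1) _ assms(2)] by force
  finally show ?thesis by simp
qed

section \<open>Classification\<close>

lemma of_cpoly_minor_prod: "of_cpoly (minor_prod rs) = (\<Prod>r\<leftarrow>rs. Delta r)"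
  by (induction rs) (simp_all add: of_cpoly_1 of_cpoly_mult Delta_eq)

lemma minor_prod_nonzero: "minor_prod rs \<noteq> 0"
  using ev_minor_prod_unit_matrix[of rs] by auto

lemma highest_weight_vector_minor_prod:
  assumes "p \<le> m" "set rs \<subseteq> {1..p}"
  shows "highest_weight_vector p m n (of_cpoly (minor_prod rs))"
  unfolding highest_weight_vector_of_cpoly_iff
  using minor_prod_nonzero vars_in_minor_prod[OF assms] unip_invariant_minor_prod[OF assms]
    row_homogeneous_minor_prod[OF assms] col_homogeneous_minor_prod[OF assms(2)] by blast

lemma row_homogeneous_cong:
  "(\<And>i. i \<in> {1..p} \<Longrightarrow> \<alpha> i = \<alpha>' i) \<Longrightarrow> row_homogeneous p m \<alpha> f \<longleftrightarrow> row_homogeneous p m \<alpha>' f"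
  by (simp add: row_homogeneous_def)

lemma col_homogeneous_cong:
  "(\<And>s. s \<in> {1..m} \<Longrightarrow> \<beta> s = \<beta>' s) \<Longrightarrow> col_homogeneous p m \<beta> f \<longleftrightarrow> col_homogeneous p m \<beta>' f"
  by (simp add: col_homogeneous_def)

lemma row_homogeneous_columns:
  assumes "p \<le> m" "young_diagram_of_length_le p lam"
  shows "row_homogeneous p m lam (minor_prod (columns lam))"
  using row_homogeneous_minor_prod[OF assms(1) set_columns[OF assms(2)]]
  by (rule row_homogeneous_cong[THEN iffD1, rotated]) (simp add: length_filter_columns[OF assms(2)])

lemma col_homogeneous_columns:
  assumes "young_diagram_of_length_le p lam"
  shows "col_homogeneous p m lam (minor_prod (columns lam))"
  using col_homogeneous_minor_prod[OF set_columns[OF assms]]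
  by (rule col_homogeneous_cong[THEN iffD1, rotated]) (simp add: length_filter_columns[OF assms])

lemma hwv_associated_columns:
  assumes "p \<le> m" "young_diagram_of_length_le p lam"
  shows "hwv_associated p m n lam (of_cpoly (minor_prod (columns lam)))"
proof -
  have "max (int (transpose_diagram lam k) - int m) 0 = 0" if "1 \<le> k" for k
    using transpose_diagram_le[OF assms(2) that] assms(1) by simp
  then show ?thesis
    unfolding hwv_associated_def has_weight_of_cpoly_iff[OF minor_prod_nonzero]
    using highest_weight_vector_minor_prod[OF assms(1) set_columns[OF assms(2)]]
      row_homogeneous_columns[OF assms] col_homogeneous_columns[OF assms(2)]
    by auto
qed

text \<open>The \<open>gl(p)\<close>-weight of \<open>F\<close> is a Young diagram, the product of the minors for its columns has the same
  weight, and the weight determines a highest weight vector up to a scalar.\<close>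

lemma highest_weight_vector_classification:
  assumes "p \<le> m" "highest_weight_vector p m n F" "has_weight p m n F a b c"
  obtains lam t where "young_diagram_of_length_le p lam" "\<And>i. i \<in> {1..p} \<Longrightarrow> a i = of_nat (lam i)"
    "t \<noteq> 0" "F = smult_super t (of_cpoly (minor_prod (columns lam)))"
proof -
  define f where "f = odd_coeff F {}"
  have F: "F = of_cpoly f"
    unfolding f_def by (rule highest_weight_vector_no_odd[OF assms(1,2)])
  have f: "f \<noteq> 0" "vars_in ({1..p} \<times> {1..m}) f" "unip_invariant p m (ev f)"
    using assms(2) unfolding F highest_weight_vector_of_cpoly_iff by blast+
  obtain \<alpha> where \<alpha>: "row_homogeneous p m \<alpha> f" "\<And>i. i \<in> {1..p} \<Longrightarrow> a i = of_nat (\<alpha> i)"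
    using assms(3) unfolding F has_weight_of_cpoly_iff[OF f(1)] by blast
  define lam where "lam i = (if i \<in> {1..p} then \<alpha> i else 0)" for i
  have lam: "row_homogeneous p m lam f"
    using \<alpha>(1) by (rule row_homogeneous_cong[THEN iffD1, rotated]) (simp add: lam_def)
  have young: "young_diagram_of_length_le p lam"
    unfolding young_diagram_of_length_le_def
  proof (intro conjI allI impI)
    fix i :: nat assume "1 \<le> i"
    then show "lam (Suc i) \<le> lam i"
      using weight_decreasing[OF assms(1) f(2) lam f(3,1), of i]
      by (cases "i < p") (auto simp: lam_def)
  qed (simp add: lam_def)
  define t where "t = ev f unit_matrix"
  have "t \<noteq> 0" unfolding t_def by (rule ev_unit_matrix_nonzero[OF assms(1) f(2) lam f(3,1)])
  moreover have "f = Poly_Mapping.single 0 t * minor_prod (columns lam)"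
    unfolding t_def
    by (rule weight_space_one_dimensional[OF assms(1) f(2) lam f(3)]
      vars_in_minor_prod[OF assms(1) set_columns[OF young]]
      row_homogeneous_columns[OF assms(1) young]
      unip_invariant_minor_prod[OF assms(1) set_columns[OF young]] ev_minor_prod_unit_matrix)+
  then have "F = smult_super t (of_cpoly (minor_prod (columns lam)))"
    by (simp add: F smult_super_of_cpoly)
  moreover have "a i = of_nat (lam i)" if "i \<in> {1..p}" for i
    using that \<alpha>(2) by (simp add: lam_def)
  ultimately show thesis using that young by blast
qed

section \<open>Classes up to nonzero scalars\<close>

lemma smult_super_smult_super: "smult_super c (smult_super d F) = smult_super (c * d) F"
  by (rule superpoly_eqI) (simp add: smult_super.rep_eq mult.assoc[symmetric] mult_single)

lemma scalar_class_smult_super: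
  assumes "c \<noteq> 0"
  shows "scalar_class (smult_super c F) = scalar_class F"
proof
  show "scalar_class (smult_super c F) \<subseteq> scalar_class F"
    using assms by (auto simp: scalar_class_def smult_super_smult_super)
  show "scalar_class F \<subseteq> scalar_class (smult_super c F)"
  proof
    fix v assume "v \<in> scalar_class F"
    then obtain d where "d \<noteq> 0" "v = smult_super d F" by (auto simp: scalar_class_def)
    then have "d / c \<noteq> 0" "v = smult_super (d / c) (smult_super c F)"
      using assms by (simp_all add: smult_super_smult_super)
    then show "v \<in> scalar_class (smult_super c F)" by (auto simp: scalar_class_def)
  qed
qed

lemma smult_super_mult_of_cpoly:
  "smult_super c (of_cpoly f) * smult_super d (of_cpoly g) = smult_super (c * d) (of_cpoly (f * g))"
proof -
  have "Poly_Mapping.single 0 c * f * (Poly_Mapping.single 0 d * g)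
      = (Poly_Mapping.single 0 c * Poly_Mapping.single 0 d) * (f * g)"
    by (simp only: mult_ac)
  then show ?thesis
    by (simp only: smult_super_of_cpoly of_cpoly_mult[symmetric] mult_single add_0_left)
qed

lemma scalar_class_mult:
  "{u * v | u v. u \<in> scalar_class (of_cpoly f) \<and> v \<in> scalar_class (of_cpoly g)}
    = scalar_class (of_cpoly (f * g))"
proof (intro subset_antisym subsetI)
  fix w assume "w \<in> {u * v | u v. u \<in> scalar_class (of_cpoly f) \<and> v \<in> scalar_class (of_cpoly g)}"
  then obtain c d where "c \<noteq> 0" "d \<noteq> 0"
    "w = smult_super c (of_cpoly f) * smult_super d (of_cpoly g)"
    by (auto simp: scalar_class_def)
  then have "c * d \<noteq> 0" "w = smult_super (c * d) (of_cpoly (f * g))"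
    by (simp_all add: smult_super_mult_of_cpoly)
  then show "w \<in> scalar_class (of_cpoly (f * g))" unfolding scalar_class_def by blast
next
  fix w assume "w \<in> scalar_class (of_cpoly (f * g))"
  then obtain c where "c \<noteq> 0" "w = smult_super c (of_cpoly (f * g))"
    by (auto simp: scalar_class_def)
  then have "w = smult_super c (of_cpoly f) * smult_super 1 (of_cpoly g)"
    by (simp only: smult_super_mult_of_cpoly mult_1_right)
  moreover have "smult_super c (of_cpoly f) \<in> scalar_class (of_cpoly f)"
    "smult_super 1 (of_cpoly g) \<in> scalar_class (of_cpoly g)"
    using \<open>c \<noteq> 0\<close> unfolding scalar_class_def by (blast, auto)
  ultimately show "w \<in> {u * v | u v. u \<in> scalar_class (of_cpoly f) \<and> v \<in> scalar_class (of_cpoly g)}"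
    by blast
qed

abbreviation minor_prod_class :: "nat list \<Rightarrow> superpoly set" where
  "minor_prod_class rs \<equiv> scalar_class (of_cpoly (minor_prod rs))"

lemma hwv_semigroup_mult:
  "minor_prod_class rs \<otimes>\<^bsub>hwv_semigroup p m n\<^esub> minor_prod_class rs' = minor_prod_class (rs @ rs')"
  by (simp add: hwv_semigroup_def scalar_class_mult minor_prod_append)

lemma hwv_semigroup_one: "\<one>\<^bsub>hwv_semigroup p m n\<^esub> = minor_prod_class []"
  by (simp add: hwv_semigroup_def of_cpoly_1)

text \<open>Lists of heights instead of diagrams describe the carrier so that the product becomes
  concatenation.\<close>

lemma carrier_hwv_semigroup:
  assumes "p \<le> m"
  shows "carrier (hwv_semigroup p m n) = minor_prod_class ` {rs. set rs \<subseteq> {1..p}}"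
proof
  show "carrier (hwv_semigroup p m n) \<subseteq> minor_prod_class ` {rs. set rs \<subseteq> {1..p}}"
  proof
    fix U assume "U \<in> carrier (hwv_semigroup p m n)"
    then obtain F where F: "highest_weight_vector p m n F" "U = scalar_class F"
      by (auto simp: hwv_semigroup_def)
    from F(1) obtain a b c where "has_weight p m n F a b c"
      unfolding highest_weight_vector_def by blast
    from highest_weight_vector_classification[OF assms F(1) this]
    obtain lam t where "young_diagram_of_length_le p lam" "t \<noteq> 0"
      "F = smult_super t (of_cpoly (minor_prod (columns lam)))" by blast
    then have "U = minor_prod_class (columns lam)" "set (columns lam) \<subseteq> {1..p}"
      using F(2) set_columns by (simp_all add: scalar_class_smult_super)
    then show "U \<in> minor_prod_class ` {rs. set rs \<subseteq> {1..p}}" by blast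
  qed
  show "minor_prod_class ` {rs. set rs \<subseteq> {1..p}} \<subseteq> carrier (hwv_semigroup p m n)"
    using highest_weight_vector_minor_prod[OF assms] by (auto simp: hwv_semigroup_def)
qed

lemma comm_monoid_hwv_semigroup:
  assumes "p \<le> m"
  shows "comm_monoid (hwv_semigroup p m n)"
proof (rule comm_monoidI)
  note carrier = carrier_hwv_semigroup[OF assms]
  fix U V W
  assume "U \<in> carrier (hwv_semigroup p m n)" "V \<in> carrier (hwv_semigroup p m n)"
  then obtain rs rs' where U: "U = minor_prod_class rs" "set rs \<subseteq> {1..p}"
    and V: "V = minor_prod_class rs'" "set rs' \<subseteq> {1..p}"
    unfolding carrier by blast
  show "U \<otimes>\<^bsub>hwv_semigroup p m n\<^esub> V \<in> carrier (hwv_semigroup p m n)"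
    unfolding U V hwv_semigroup_mult carrier by (rule imageI) (use U V in simp)
  show "U \<otimes>\<^bsub>hwv_semigroup p m n\<^esub> V = V \<otimes>\<^bsub>hwv_semigroup p m n\<^esub> U"
    unfolding U V hwv_semigroup_mult by (simp add: minor_prod_append mult.commute)
  assume "W \<in> carrier (hwv_semigroup p m n)"
  then obtain rs'' where W: "W = minor_prod_class rs''"
    unfolding carrier by blast
  show "U \<otimes>\<^bsub>hwv_semigroup p m n\<^esub> V \<otimes>\<^bsub>hwv_semigroup p m n\<^esub> W
      = U \<otimes>\<^bsub>hwv_semigroup p m n\<^esub> (V \<otimes>\<^bsub>hwv_semigroup p m n\<^esub> W)"
    unfolding U V W hwv_semigroup_mult by simp
next
  show "\<one>\<^bsub>hwv_semigroup p m n\<^esub> \<in> carrier (hwv_semigroup p m n)"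
    unfolding hwv_semigroup_one carrier_hwv_semigroup[OF assms] by (rule imageI) simp
next
  fix U assume "U \<in> carrier (hwv_semigroup p m n)"
  then obtain rs where U: "U = minor_prod_class rs"
    unfolding carrier_hwv_semigroup[OF assms] by blast
  show "\<one>\<^bsub>hwv_semigroup p m n\<^esub> \<otimes>\<^bsub>hwv_semigroup p m n\<^esub> U = U"
    unfolding U hwv_semigroup_one hwv_semigroup_mult by simp
qed

lemma generated_hwv_semigroup:
  assumes "p \<le> m"
  shows "carrier (hwv_semigroup p m n) =
    generated_submonoid (hwv_semigroup p m n) ((\<lambda>r. scalar_class (Delta r)) ` {1..p})"
    (is "_ = generated_submonoid ?G ?S")
proof
  have Delta: "scalar_class (Delta r) = minor_prod_class [r]" for r
    by (simp add: Delta_eq)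
  show "carrier ?G \<subseteq> generated_submonoid ?G ?S"
  proof
    fix U assume "U \<in> carrier ?G"
    then obtain rs where U: "U = minor_prod_class rs" "set rs \<subseteq> {1..p}"
      unfolding carrier_hwv_semigroup[OF assms] by blast
    from U(2) have "minor_prod_class rs \<in> generated_submonoid ?G ?S"
    proof (induction rs)
      case Nil
      show ?case using generated_submonoid.one[of ?G ?S] unfolding hwv_semigroup_one .
    next
      case (Cons r rs)
      then have "minor_prod_class [r] \<in> generated_submonoid ?G ?S"
        unfolding Delta[of r, symmetric]
        by (intro generated_submonoid.incl imageI) simp
      with Cons have "minor_prod_class [r] \<otimes>\<^bsub>?G\<^esub> minor_prod_class rs \<in> generated_submonoid ?G ?S"
        by (intro generated_submonoid.mult) auto
      then show ?case unfolding hwv_semigroup_mult by simp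
    qed
    with U(1) show "U \<in> generated_submonoid ?G ?S" by simp
  qed
  show "generated_submonoid ?G ?S \<subseteq> carrier ?G"
  proof
    interpret comm_monoid ?G by (rule comm_monoid_hwv_semigroup[OF assms])
    fix U assume "U \<in> generated_submonoid ?G ?S"
    then show "U \<in> carrier ?G"
    proof induction
      case (incl U)
      then obtain r where r: "r \<in> {1..p}" "U = minor_prod_class [r]"
        unfolding Delta by blast
      show ?case unfolding carrier_hwv_semigroup[OF assms] r(2) by (rule imageI) (use r(1) in simp)
    qed auto
  qed
qed

lemma hwv_associated_smult_super:
  assumes "t \<noteq> 0" "hwv_associated p m n lam (of_cpoly f)"
  shows "hwv_associated p m n lam (smult_super t (of_cpoly f))"
proof -
  define g where "g = Poly_Mapping.single 0 t * f"
  have ev_g: "ev g X = t * ev f X" for X by (simp add: g_def)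
  have f: "f \<noteq> 0" "vars_in ({1..p} \<times> {1..m}) f" "unip_invariant p m (ev f)"
    using assms(2) unfolding hwv_associated_def highest_weight_vector_of_cpoly_iff by blast+
  obtain X where "ev f X \<noteq> 0" using f(1) cpoly_eqI[of f 0] by auto
  then have "ev g X \<noteq> 0" using assms(1) by (simp add: ev_g)
  then have g: "g \<noteq> 0" by auto
  have "vars_in ({1..p} \<times> {1..m}) g"
    unfolding g_def by (intro vars_in_mult vars_in_single f) simp
  moreover have "unip_invariant p m (ev g)"
    using f(3) by (simp add: unip_invariant_def ev_g)
  moreover have "row_homogeneous p m \<alpha> g \<longleftrightarrow> row_homogeneous p m \<alpha> f" for \<alpha>
    using assms(1) by (simp add: row_homogeneous_def ev_g mult.left_commute[of t])
  moreover have "col_homogeneous p m \<beta> g \<longleftrightarrow> col_homogeneous p m \<beta> f" for \<beta>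
    using assms(1) by (simp add: col_homogeneous_def ev_g mult.left_commute[of t])
  ultimately have "hwv_associated p m n lam (of_cpoly g)"
    using assms(2) f g
    unfolding hwv_associated_def highest_weight_vector_of_cpoly_iff
      has_weight_of_cpoly_iff[OF f(1)] has_weight_of_cpoly_iff[OF g] by simp
  then show ?thesis by (simp add: g_def smult_super_of_cpoly)
qed

text \<open>The classification produces a diagram \<open>lam'\<close> with the same rows \<open>1, \<dots>, p\<close> as \<open>lam\<close>; the two may differ
  at the meaningless index \<open>0\<close>, which does not affect the columns.\<close>

lemma hwv_associated_eq_scalar_class:
  assumes "p \<le> m" "young_diagram_of_length_le p lam"
  shows "{v. hwv_associated p m n lam v} = minor_prod_class (columns lam)"
proof (intro subset_antisym subsetI)
  fix v assume "v \<in> {v. hwv_associated p m n lam v}"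
  then have v: "highest_weight_vector p m n v"
    and w: "has_weight p m n v (\<lambda>i. of_nat (lam i)) (\<lambda>s. of_nat (lam s))
       (\<lambda>k. of_int (max (int (transpose_diagram lam k) - int m) 0))"
    by (simp_all add: hwv_associated_def)
  obtain lam' t where lam': "young_diagram_of_length_le p lam'"
    "\<And>i. i \<in> {1..p} \<Longrightarrow> (of_nat (lam i) :: complex) = of_nat (lam' i)"
    "t \<noteq> 0" "v = smult_super t (of_cpoly (minor_prod (columns lam')))"
    using highest_weight_vector_classification[OF assms(1) v w] by blast
  have eq: "lam i = lam' i" if "1 \<le> i" for i
    using that lam'(1) lam'(2)[of i] assms(2)
    by (cases "i \<le> p") (auto simp: young_diagram_of_length_le_def)
  have "transpose_diagram lam = transpose_diagram lam'"
    unfolding transpose_diagram_def by (intro ext arg_cong[of _ _ card]) (use eq in auto)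
  then have "columns lam' = columns lam" using eq[of 1] by (simp add: columns_def)
  with lam'(3,4) show "v \<in> minor_prod_class (columns lam)" by (auto simp: scalar_class_def)
next
  fix v assume "v \<in> minor_prod_class (columns lam)"
  then show "v \<in> {v. hwv_associated p m n lam v}"
    using hwv_associated_smult_super[OF _ hwv_associated_columns[OF assms]]
    by (auto simp: scalar_class_def)
qed

theorem theorem4p1:
  fixes p m n :: nat
  assumes "p \<le> m"
  shows "comm_monoid (hwv_semigroup p m n) \<and>
    carrier (hwv_semigroup p m n) =
      generated_submonoid (hwv_semigroup p m n) ((\<lambda>r. scalar_class (Delta r)) ` {1..p}) \<and>
    (\<forall>lam. young_diagram_of_length_le p lam \<longrightarrow>
      {v. hwv_associated p m n lam v} =
        scalar_class (\<Prod>j\<leftarrow>[1..<Suc (lam 1)]. Delta (transpose_diagram lam j)))"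
proof (intro conjI allI impI)
  fix lam assume "young_diagram_of_length_le p lam"
  then have "{v. hwv_associated p m n lam v} = minor_prod_class (columns lam)"
    by (rule hwv_associated_eq_scalar_class[OF assms])
  also have "of_cpoly (minor_prod (columns lam))
      = (\<Prod>j\<leftarrow>[1..<Suc (lam 1)]. Delta (transpose_diagram lam j))"
    unfolding of_cpoly_minor_prod columns_def by (simp only: map_map o_def)
  finally show "{v. hwv_associated p m n lam v}
      = scalar_class (\<Prod>j\<leftarrow>[1..<Suc (lam 1)]. Delta (transpose_diagram lam j))" .
qed (rule comm_monoid_hwv_semigroup[OF assms] generated_hwv_semigroup[OF assms])+

end
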